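(* For each $\Lambda,\Omega,s\in\mathbb N$ and each $\gamma,\epsilon,\rho>0$ there exist $k_0\in\mathbb{N}$, $\nu>0$ such that for every $k\ge k_0$ and every $n$-vertex graph $G$ with $e(G)\le kn$, $\Delta(G)\le \Omega k$, and with a given partition $\mathcal V$ of its vertex set into at most $s$ sets, and for any given number $b$, there exists a $(k,\Lambda,\gamma,\epsilon,\nu,\rho)$-bounded decomposition $(\mathbf V,\mathcal D, G_{\mathrm{reg}}, G_{\mathrm{exp}},\mathfrak A)$ of $G$ with respect to $\mathcal V$ which captures all but at most $(\frac{4\epsilon}{\gamma}+\epsilon\Omega+\gamma+\rho)kn$ edges of $G$. Furthermore, this bounded decomposition respects the avoiding threshold $b$, and we have $$\Big|E(\mathcal D)\setminus \big(E(G_{\mathrm{reg}})\cup E_G[\mathfrak A,\mathfrak A\cup\textstyle\bigcup\mathbf V]\big)\Big|\le \Big(\frac{4\epsilon}{\gamma}+\epsilon\Omega +\gamma\Big) kn .$$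
   Context: Graphs are finite and simple; $\Delta(G)$ is the maximum degree; $e(G)$ the number of edges; subgraphs have their own vertex sets; the null graph (no vertices) is allowed as a subgraph and has minimum degree $\infty$ by convention. $\deg(v,U)$ is the number of neighbours of $v$ in $U$. For disjoint vertex sets $U,W$, $e(U,W)$ is the number of edges between them, and $\mathrm d(U,W)=e(U,W)/(|U||W|)$. A pair $(U,W)$ of disjoint sets is $\epsilon$-regular if $|\mathrm d(U,W)-\mathrm d(U',W')|<\epsilon$ for all $U'\subseteq U$, $W'\subseteq W$ with $|U'|\ge\epsilon|U|$, $|W'|\ge\epsilon|W|$. Dense spots: an $(m,\gamma)$-dense spot in $G$ is a non-empty bipartite subgraph $D=(U,W;F)$ of $G$ (colour classes $U,W$, edge set $F$) with $|F|/(|U||W|)>\gamma$ and minimum degree greater than $m$; $(U,W;F)$ and $(W,U;F)$ are considered the same object. $G$ is $(m,\gamma)$-nowhere-dense if it contains no $(m,\gamma)$-dense spot. For a family $\mathcal D$ of dense spots, $E(\mathcal D)$ is the union of their edge sets. Avoiding set: given a family $\mathcal D$ of dense spots in $G$, a set $\mathfrak A\subseteq\bigcup_{D\in\mathcal D}V(D)$ is $(\Lambda,\epsilon,\gamma,k)$-avoiding with respect to $\mathcal D$ if for every $\bar U\subseteq V(G)$ with $|\bar U|\le\Lambda k$ the following holds for all but at most $\epsilon k$ vertices $v\in\mathfrak A$: there is a dense spot $D\in\mathcal D$ containing $v$ with $|\bar U\cap V(D)|\le\gamma^2k$. Bounded decomposition: let $\mathcal V$ be a partition of $V(G)$. $(\mathbf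 V,\mathcal D,G_{\mathrm{reg}},G_{\mathrm{exp}},\mathfrak A)$ is a $(k,\Lambda,\gamma,\epsilon,\nu,\rho)$-bounded decomposition of $G$ with respect to $\mathcal V$ if: 1. The elements of $\mathbf V$ (called clusters) are disjoint subsets of $V(G)$. 2. $G_{\mathrm{reg}}$ is a subgraph of $G-G_{\mathrm{exp}}$ (delete the edges of $G_{\mathrm{exp}}$) on the vertex set $\bigcup\mathbf V$. For each edge $xy\in E(G_{\mathrm{reg}})$ there are distinct $C_x\ni x$, $C_y\ni y$ in $\mathbf V$ with $G[C_x,C_y]=G_{\mathrm{reg}}[C_x,C_y]$, and $G[C_x,C_y]$ forms an $\epsilon$-regular pair of density at least $\gamma^2$. 3. $\nu k\le|C|=|C'|\le\epsilon k$ for all $C,C'\in\mathbf V$. 4. $\mathcal D$ is a family of edge-disjoint $(\gamma k,\gamma)$-dense spots in $G-G_{\mathrm{exp}}$. For each $D=(U,W;F)\in\mathcal D$ all the edges of $G[U,W]$ are covered by $\mathcal D$ (but not necessarily by $D$). 5. If $G_{\mathrm{reg}}$ contains at least one edge between $C_1,C_2\in\mathbf V$ then there is a dense spot $D=(U,W;F)\in\mathcal D$ with $C_1\subseteq U$, $C_2\subseteq W$. 6. For all $C\in\mathbf V$ there is $V\in\mathcal V$ with either $C\subseteq V\cap V(G_{\mathrm{exp}})$ or $C\subseteq V\setminus V(G_{\mathrm{exp}})$. For all $C\in\mathbf V$ and $D=(U,W;F)\in\mathcal D$ we have $C\cap U\in\{\emptyset,C\}$. 7. $G_{\mathrm{exp}}$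 is a $(\gamma k,\gamma)$-nowhere-dense subgraph of $G$ with minimum degree greater than $\rho k$. 8. $\mathfrak A$ is a $(\Lambda,\epsilon,\gamma,k)$-avoiding subset of $V(G)\setminus\bigcup\mathbf V$ with respect to $\mathcal D$. It respects the avoiding threshold $b$ if for each $C\in\mathbf V$ either $\deg_G(v,\mathfrak A)\le b$ for all $v\in C$, or $\deg_G(v,\mathfrak A)>b$ for all $v\in C$. The edges captured by the bounded decomposition are those in $E(G_{\mathrm{reg}})\cup E(G_{\mathrm{exp}})\cup E_G[\mathfrak A,\mathfrak A\cup\bigcup\mathbf V]$, where $E_G[X,Y]$ denotes the set of edges of $G$ with one endpoint in $X$ and the other in $Y$. *)

theory Defs
  imports "HOL-Analysis.Analysis" "HOL-Library.Disjoint_Sets" "HOL-Library.Uprod"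
begin

section \<open>Finite simple graphs\<close>

record 'a graph =
  verts :: "'a set"
  edges :: "'a set set"

definition simple_graph :: "'a graph \<Rightarrow> bool" where
  "simple_graph G \<longleftrightarrow> finite (verts G) \<and> (\<forall>e\<in>edges G. e \<subseteq> verts G \<and> card e = 2)"

definition subgraph :: "'a graph \<Rightarrow> 'a graph \<Rightarrow> bool" where
  "subgraph H G \<longleftrightarrow> simple_graph H \<and> verts H \<subseteq> verts G \<and> edges H \<subseteq> edges G"

definition delete_edges :: "'a graph \<Rightarrow> 'a graph \<Rightarrow> 'a graph" where
  "delete_edges G H = \<lparr>verts = verts G, edges = edges G - edges H\<rparr>"

definition deg_in :: "'a graph \<Rightarrow> 'a \<Rightarrow> 'a set \<Rightarrow> nat" where
  "deg_in G v U = card {u \<in> U. {v, u} \<in> edges G}"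

definition degree :: "'a graph \<Rightarrow> 'a \<Rightarrow> nat" where
  "degree G v = deg_in G v (verts G)"

text \<open>Inserting 0 only affects the null graph, whose maximum degree is thus 0.\<close>

definition max_degree :: "'a graph \<Rightarrow> nat" where
  "max_degree G = Max (insert 0 (degree G ` verts G))"

text \<open>The infimum is taken in the extended reals, so the null graph has minimum degree
  \<open>\<infinity>\<close>.\<close>

definition min_degree :: "'a graph \<Rightarrow> ereal" where
  "min_degree G = (INF v\<in>verts G. ereal (real (degree G v)))"

text \<open>\<open>edges_between G X Y\<close> is $E_G[X,Y]$; the sets need not be disjoint.\<close>

definition edges_between :: "'a graph \<Rightarrow> 'a set \<Rightarrow> 'a set \<Rightarrow> 'a set set" where
  "edges_between G X Y = {e \<in> edges G. \<exists>x\<in>X. \<exists>y\<in>Y. e = {x, y}}"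

definition density :: "'a graph \<Rightarrow> 'a set \<Rightarrow> 'a set \<Rightarrow> real" where
  "density G U W = real (card (edges_between G U W)) / (real (card U) * real (card W))"

definition regular_pair :: "real \<Rightarrow> 'a graph \<Rightarrow> 'a set \<Rightarrow> 'a set \<Rightarrow> bool" where
  "regular_pair \<epsilon> G U W \<longleftrightarrow> U \<inter> W = {} \<and>
     (\<forall>U' W'. U' \<subseteq> U \<longrightarrow> W' \<subseteq> W \<longrightarrow>
        real (card U') \<ge> \<epsilon> * real (card U) \<longrightarrow> real (card W') \<ge> \<epsilon> * real (card W) \<longrightarrow>
        \<bar>density G U W - density G U' W'\<bar> < \<epsilon>)"


section \<open>Dense spots\<close>

text \<open>A bipartite graph $(U,W;F)$ together with its colour classes. The classes form an
  unordered pair, so \<open>Spot (Upair U W) F = Spot (Upair W U) F\<close>; statements below that are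
  quantified over \<open>U\<close> and \<open>W\<close> therefore apply to both orders.\<close>

datatype 'a spot = Spot (spot_classes: "'a set uprod") (spot_edges: "'a set set")

definition spot_verts :: "'a spot \<Rightarrow> 'a set" where
  "spot_verts D = \<Union>(set_uprod (spot_classes D))"

definition spot_graph :: "'a spot \<Rightarrow> 'a graph" where
  "spot_graph D = \<lparr>verts = spot_verts D, edges = spot_edges D\<rparr>"

text \<open>Non-emptiness is the condition \<open>F \<noteq> {}\<close>; for \<open>m \<ge> 0\<close> the minimum degree condition makes
  it equivalent to having a vertex.\<close>

definition dense_spot :: "real \<Rightarrow> real \<Rightarrow> 'a graph \<Rightarrow> 'a spot \<Rightarrow> bool" where
  "dense_spot m \<gamma> G D \<longleftrightarrow> (\<exists>U W F. D = Spot (Upair U W) F \<and>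
     U \<inter> W = {} \<and> (\<forall>e\<in>F. \<exists>u\<in>U. \<exists>w\<in>W. e = {u, w}) \<and> F \<noteq> {} \<and>
     subgraph (spot_graph D) G \<and>
     real (card F) / (real (card U) * real (card W)) > \<gamma> \<and>
     min_degree (spot_graph D) > ereal m)"

definition nowhere_dense_graph :: "real \<Rightarrow> real \<Rightarrow> 'a graph \<Rightarrow> bool" where
  "nowhere_dense_graph m \<gamma> G \<longleftrightarrow> \<not> (\<exists>D. dense_spot m \<gamma> G D)"

definition family_edges :: "'a spot set \<Rightarrow> 'a set set" where
  "family_edges \<D> = (\<Union>D\<in>\<D>. spot_edges D)"


section \<open>Bounded decompositions\<close>

definition avoiding ::
    "real \<Rightarrow> real \<Rightarrow> real \<Rightarrow> nat \<Rightarrow> 'a graph \<Rightarrow> 'a spot set \<Rightarrow> 'a set \<Rightarrow> bool" where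
  "avoiding \<Lambda> \<epsilon> \<gamma> k G \<D> A \<longleftrightarrow> A \<subseteq> (\<Union>D\<in>\<D>. spot_verts D) \<and>
     (\<forall>U. U \<subseteq> verts G \<longrightarrow> real (card U) \<le> \<Lambda> * real k \<longrightarrow>
        real (card {v \<in> A. \<not> (\<exists>D\<in>\<D>. v \<in> spot_verts D \<and>
                                 real (card (U \<inter> spot_verts D)) \<le> \<gamma>\<^sup>2 * real k)})
          \<le> \<epsilon> * real k)"

text \<open>\<open>\<V>\<close> is the given partition of the vertex set, \<open>\<C>\<close> the set of clusters.\<close>

definition bounded_decomposition ::
    "nat \<Rightarrow> real \<Rightarrow> real \<Rightarrow> real \<Rightarrow> real \<Rightarrow> real \<Rightarrow> 'a graph \<Rightarrow> 'a set set \<Rightarrow>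
     'a set set \<Rightarrow> 'a spot set \<Rightarrow> 'a graph \<Rightarrow> 'a graph \<Rightarrow> 'a set \<Rightarrow> bool" where
  "bounded_decomposition k \<Lambda> \<gamma> \<epsilon> \<nu> \<rho> G \<V> \<C> \<D> Greg Gexp A \<longleftrightarrow>
     (disjoint \<C> \<and> (\<forall>C\<in>\<C>. C \<subseteq> verts G)) \<and>

     (subgraph Greg (delete_edges G Gexp) \<and> verts Greg = \<Union>\<C> \<and>
      (\<forall>x y. {x, y} \<in> edges Greg \<longrightarrow>
         (\<exists>Cx\<in>\<C>. \<exists>Cy\<in>\<C>. Cx \<noteq> Cy \<and> x \<in> Cx \<and> y \<in> Cy \<and>
            edges_between G Cx Cy = edges_between Greg Cx Cy \<and>
            regular_pair \<epsilon> G Cx Cy \<and> density G Cx Cy \<ge> \<gamma>\<^sup>2))) \<and>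

     (\<forall>C\<in>\<C>. \<forall>C'\<in>\<C>. \<nu> * real k \<le> real (card C) \<and> card C = card C' \<and>
         real (card C') \<le> \<epsilon> * real k) \<and>

     ((\<forall>D\<in>\<D>. dense_spot (\<gamma> * real k) \<gamma> (delete_edges G Gexp) D) \<and>
      disjoint_family_on spot_edges \<D> \<and>
      (\<forall>U W F. Spot (Upair U W) F \<in> \<D> \<longrightarrow> edges_between G U W \<subseteq> family_edges \<D>)) \<and>

     (\<forall>C1\<in>\<C>. \<forall>C2\<in>\<C>. edges_between Greg C1 C2 \<noteq> {} \<longrightarrow>
        (\<exists>U W F. Spot (Upair U W) F \<in> \<D> \<and> C1 \<subseteq> U \<and> C2 \<subseteq> W)) \<and>

     ((\<forall>C\<in>\<C>. \<exists>V\<in>\<V>. C \<subseteq> V \<inter> verts Gexp \<or> C \<subseteq> V - verts Gexp) \<and>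
      (\<forall>C\<in>\<C>. \<forall>U W F. Spot (Upair U W) F \<in> \<D> \<longrightarrow> C \<inter> U \<in> {{}, C})) \<and>

     (subgraph Gexp G \<and> nowhere_dense_graph (\<gamma> * real k) \<gamma> Gexp \<and>
      min_degree Gexp > ereal (\<rho> * real k)) \<and>

     (A \<subseteq> verts G - \<Union>\<C> \<and> avoiding \<Lambda> \<epsilon> \<gamma> k G \<D> A)"

definition respects_threshold :: "real \<Rightarrow> 'a graph \<Rightarrow> 'a set set \<Rightarrow> 'a set \<Rightarrow> bool" where
  "respects_threshold b G \<C> A \<longleftrightarrow>
     (\<forall>C\<in>\<C>. (\<forall>v\<in>C. real (deg_in G v A) \<le> b) \<or> (\<forall>v\<in>C. real (deg_in G v A) > b))"

definition captured_edges ::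
    "'a graph \<Rightarrow> 'a set set \<Rightarrow> 'a graph \<Rightarrow> 'a graph \<Rightarrow> 'a set \<Rightarrow> 'a set set" where
  "captured_edges G \<C> Greg Gexp A =
     edges Greg \<union> edges Gexp \<union> edges_between G A (A \<union> \<Union>\<C>)"

end

theory Submission
  imports Defs
begin

text \<open>
  Fix a family \<open>\<D>\<close> of edge-disjoint dense spots covering as many edges as possible. Maximality has
  two consequences: an uncovered edge of \<open>G\<close> running between the classes of a spot of \<open>\<D>\<close> could be added
  to that spot, so there is none; and the uncovered edges contain no dense spot at all, since it
  could be added to \<open>\<D>\<close>. Hence the uncovered edges, pruned to minimum degree above \<open>\<rho>k\<close> at the
  price of \<open>\<rho>kn\<close> edges, serve as \<open>Gexp\<close>, and the remaining task is to capture almost all of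
  \<open>E(\<D>)\<close>.

  Since the spots are edge-disjoint and of minimum degree above \<open>\<gamma>k\<close>, every vertex lies in at most
  \<open>\<Omega>/\<gamma>\<close> of them. Label a vertex by the set of spot classes that contain it, by its part of \<open>\<V>\<close>,
  and by whether it lies in \<open>Gexp\<close>. A set of at most \<open>\<Lambda>k\<close> vertices meets only boundedly many spots
  in more than \<open>\<gamma>\<^sup>2k\<close> vertices, and a vertex all of whose spots are among those carries one of a
  bounded number of labels. So if \<open>A\<close> consists of the spot vertices whose label occurs fewer than
  \<open>tk\<close> times, for a small constant \<open>t\<close>, then \<open>A\<close> is avoiding (\<open>avoiding_rare\<close>). On the other
  spot vertices there are at most \<open>n/(tk)\<close> labels, and a further split by degree into \<open>A\<close> at most
  doubles this.

  It remains to regularise \<open>E(\<D>)\<close> inside these label classes (\<open>bounded_degree_regularity\<close>). The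
  number of classes is unbounded, so the usual regularity lemma does not apply, but its proof does.
  A cluster of size at least \<open>\<nu>k\<close> in a graph of maximum degree \<open>\<Omega>k\<close> has boundedly many partners
  with which it spans density at least \<open>\<gamma>\<^sup>2\<close>. So all witnesses of irregularity of dense pairs can be
  used simultaneously while each cluster is cut into a bounded number of pieces. If
  irregular dense pairs carry more than \<open>(4\<epsilon>/\<gamma>)kn\<close> edges, the mean-square density rises by a fixed
  multiple of \<open>kn\<close>, whereas it never exceeds \<open>\<Omega>kn\<close>; so a bounded number of rounds suffices.

  The edges of \<open>E(\<D>)\<close> that escape are of three kinds (\<open>card_lost_edges\<close>): those at the at most
  \<open>\<epsilon>n\<close> leftover vertices, those in irregular dense pairs, and those in pairs of density below
  \<open>\<gamma>\<^sup>2\<close>. Of the last kind, a spot \<open>(U,W;F)\<close> contains at most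
  \<open>\<gamma>\<^sup>2|U||W| \<le> \<gamma>|F|\<close>, which sums to at most \<open>\<gamma>kn\<close>. These are the three terms of the bound.
\<close>

section \<open>Energy of a partition\<close>

text \<open>The proportion of \<open>S\<close> that lies in \<open>E\<close>. When \<open>S\<close> is a rectangle \<open>A \<times> B\<close> and \<open>E\<close> an adjacency
  relation, this is the density of the pair \<open>(A, B)\<close>. Working with subsets of a product turns all
  energy estimates into statements about ordinary one-dimensional partitions.\<close>

definition share :: "'a set \<Rightarrow> 'a set \<Rightarrow> real" where
  "share E S = real (card (E \<inter> S)) / real (card S)"

text \<open>The mean-square density of Szemeredi's proof, without normalisation: for a graph of maximum degree
  \<open>\<Omega>k\<close> its natural scale is \<open>kn\<close> rather than \<open>n\<^sup>2\<close>.\<close>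

definition energy :: "'a set \<Rightarrow> 'a set set \<Rightarrow> real" where
  "energy E P = (\<Sum>S\<in>P. real (card S) * (share E S)\<^sup>2)"

lemma card_times_share: "finite S \<Longrightarrow> real (card S) * share E S = real (card (E \<inter> S))"
  by (cases "S = {}") (auto simp: share_def)

lemma share_le_1: "share E S \<le> 1"
proof (cases "finite S")
  case True
  then have "card (E \<inter> S) \<le> card S" by (simp add: card_mono)
  then show ?thesis by (auto simp: share_def divide_le_eq_1)
qed (simp add: share_def)

lemma sum_card_Int_partition:
  assumes "finite S" "partition_on S Q"
  shows "(\<Sum>B\<in>Q. real (card (E \<inter> B))) = real (card (E \<inter> S))"
proof -
  have "(\<Sum>B\<in>Q. real (card (E \<inter> B))) = real (\<Sum>B\<in>Q. card (E \<inter> B))" by simp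
  also have "(\<Sum>B\<in>Q. card (E \<inter> B)) = card (\<Union>B\<in>Q. E \<inter> B)"
    using assms finite_elements[OF assms]
    by (subst card_UN_disjoint) (auto simp: partition_on_def disjoint_def intro: finite_subset)
  also have "(\<Union>B\<in>Q. E \<inter> B) = E \<inter> S"
    using assms(2) by (auto simp: partition_on_def)
  finally show ?thesis .
qed

text \<open>A share is at most 1, so squaring it only decreases each summand.\<close>

lemma energy_le_card:
  assumes "finite Z" "partition_on Z P"
  shows "energy E P \<le> real (card (E \<inter> Z))"
proof -
  have fin: "finite S" if "S \<in> P" for S
    using assms that by (metis finite_subset partition_onD1 Union_upper)
  have "energy E P \<le> (\<Sum>S\<in>P. real (card (E \<inter> S)))"
    unfolding energy_def
  proof (rule sum_mono)
    fix S assume "S \<in> P"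
    have "real (card S) * (share E S)\<^sup>2 = real (card (E \<inter> S)) * share E S"
      using card_times_share[OF fin[OF \<open>S \<in> P\<close>], of E] by (simp add: power2_eq_square)
    also have "\<dots> \<le> real (card (E \<inter> S))"
      using share_le_1[of E S] by (simp add: mult_left_le)
    finally show "real (card S) * (share E S)\<^sup>2 \<le> real (card (E \<inter> S))" .
  qed
  also have "\<dots> = real (card (E \<inter> Z))" by (rule sum_card_Int_partition[OF assms])
  finally show ?thesis .
qed

text \<open>Decomposition of variance: the mean of the shares of the pieces, weighted by size, is the share
  of the whole.\<close>

lemma share_variance_partition:
  assumes "finite S" "partition_on S Q"
  shows "energy E Q = real (card S) * (share E S)\<^sup>2
           + (\<Sum>B\<in>Q. real (card B) * (share E B - share E S)\<^sup>2)"
proof -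
  define d where "d = share E S"
  have fin: "finite B" if "B \<in> Q" for B
    using assms that by (metis finite_subset partition_onD1 Union_upper)
  have c: "(\<Sum>B\<in>Q. real (card B)) = real (card S)"
    using sum_card_Int_partition[OF assms, of UNIV] by simp
  have "(\<Sum>B\<in>Q. real (card B) * (share E B - d)\<^sup>2)
      = (\<Sum>B\<in>Q. real (card B) * (share E B)\<^sup>2 - 2 * d * real (card (E \<inter> B)) + d\<^sup>2 * real (card B))"
    by (rule sum.cong) (auto simp: card_times_share[OF fin, symmetric] power2_eq_square algebra_simps)
  also have "\<dots> = energy E Q - 2 * d * real (card (E \<inter> S)) + d\<^sup>2 * real (card S)"
    by (simp add: energy_def sum.distrib sum_subtractf sum_distrib_left[symmetric]
        sum_card_Int_partition[OF assms] c)
  also have "\<dots> = energy E Q - real (card S) * d\<^sup>2"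
    by (simp add: card_times_share[OF assms(1), symmetric] d_def power2_eq_square)
  finally show ?thesis by (simp add: d_def)
qed

text \<open>Apply the variance decomposition and keep only the pieces inside \<open>T\<close>; by Cauchy-Schwarz their
  contribution is smallest when their shares all equal that of \<open>T\<close>.\<close>

lemma energy_gain_part:
  assumes S: "finite S" "partition_on S Q"
    and T: "T \<subseteq> S" "\<And>B. B \<in> Q \<Longrightarrow> B \<subseteq> T \<or> B \<inter> T = {}"
  shows "real (card S) * (share E S)\<^sup>2 + real (card T) * (share E T - share E S)\<^sup>2 \<le> energy E Q"
proof -
  define d where "d = share E S"
  define R where "R = {B \<in> Q. B \<subseteq> T}"
  have finQ: "finite Q" using S finite_elements by blast
  have fT: "finite T" using S(1) T(1) finite_subset by blast
  have fin: "finite B" if "B \<in> Q" for B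
    using S that by (metis finite_subset partition_onD1 Union_upper)
  have R: "partition_on T R"
  proof (rule partition_onI)
    show "\<Union>R = T"
    proof
      show "T \<subseteq> \<Union>R"
      proof
        fix x assume "x \<in> T"
        then obtain B where "B \<in> Q" "x \<in> B" using S(2) T(1) by (auto simp: partition_on_def)
        with T(2)[of B] \<open>x \<in> T\<close> show "x \<in> \<Union>R" by (auto simp: R_def)
      qed
    qed (auto simp: R_def)
  next
    show "{} \<notin> R" using S(2) by (auto simp: R_def partition_on_def)
  next
    show "\<And>p q. p \<in> R \<Longrightarrow> q \<in> R \<Longrightarrow> p \<noteq> q \<Longrightarrow> disjnt p q"
      using S(2) by (auto simp: R_def partition_on_def disjoint_def disjnt_def)
  qed
  have c: "(\<Sum>B\<in>R. real (card B)) = real (card T)"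
    using sum_card_Int_partition[OF fT R, of UNIV] by simp
  have finR: "finite B" if "B \<in> R" for B using that fin by (auto simp: R_def)
  have "real (card T) * (share E T - d) = (\<Sum>B\<in>R. real (card B) * (share E B - d))"
    using card_times_share[OF fT, of E] sum_card_Int_partition[OF fT R, of E] c
    by (simp add: right_diff_distrib sum_subtractf card_times_share[OF finR] sum_distrib_right[symmetric])
  also have "\<dots> = (\<Sum>B\<in>R. sqrt (real (card B)) * (sqrt (real (card B)) * (share E B - d)))"
    by (simp add: mult.assoc[symmetric])
  finally have "(real (card T) * (share E T - d))\<^sup>2
      \<le> (\<Sum>B\<in>R. (sqrt (real (card B)))\<^sup>2) * (\<Sum>B\<in>R. (sqrt (real (card B)) * (share E B - d))\<^sup>2)"
    using Cauchy_Schwarz_ineq_sum by metis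
  also have "\<dots> = real (card T) * (\<Sum>B\<in>R. real (card B) * (share E B - d)\<^sup>2)"
    by (simp add: c power_mult_distrib)
  finally have *: "(real (card T) * (share E T - d))\<^sup>2
    \<le> real (card T) * (\<Sum>B\<in>R. real (card B) * (share E B - d)\<^sup>2)" .
  have "real (card T) * (share E T - d)\<^sup>2 \<le> (\<Sum>B\<in>R. real (card B) * (share E B - d)\<^sup>2)"
  proof (cases "card T = 0")
    case True then show ?thesis by (simp add: sum_nonneg)
  next
    case False
    then show ?thesis using * by (simp add: power2_eq_square mult.assoc mult.left_commute)
  qed
  also have "\<dots> \<le> (\<Sum>B\<in>Q. real (card B) * (share E B - d)\<^sup>2)"
    using finQ by (intro sum_mono2) (auto simp: R_def)
  finally show ?thesis
    using share_variance_partition[OF S, of E] by (simp add: d_def)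
qed

text \<open>Choosing \<open>T S = S\<close> contributes nothing, so one statement covers both the monotonicity of the energy
  under refinement and the gain on those parts for which a deviating subset is available.\<close>

lemma energy_gain:
  assumes fin: "finite Z" and ref: "refines Z Q P"
    and T: "\<And>S. S \<in> P \<Longrightarrow> T S \<subseteq> S"
      "\<And>S B. S \<in> P \<Longrightarrow> B \<in> Q \<Longrightarrow> B \<subseteq> T S \<or> B \<inter> T S = {}"
  shows "energy E P + (\<Sum>S\<in>P. real (card (T S)) * (share E (T S) - share E S)\<^sup>2) \<le> energy E Q"
proof -
  have Z: "partition_on Z P" "partition_on Z Q" using ref by (auto simp: refines_def)
  have finP: "finite P" and finQ: "finite Q" using fin Z finite_elements by blast+
  define QS where "QS S = {B \<in> Q. B \<subseteq> S}" for S
  have part: "partition_on S (QS S)" if "S \<in> P" for S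
    unfolding QS_def using refines_obtains_subset[OF ref that] .
  have U: "Q = (\<Union>S\<in>P. QS S)" using ref by (auto simp: QS_def refines_def)
  have dis: "QS S \<inter> QS S' = {}" if "S \<in> P" "S' \<in> P" "S \<noteq> S'" for S S'
  proof -
    have "S \<inter> S' = {}" using that Z(1) by (auto simp: partition_on_def disjoint_def)
    moreover have "{} \<notin> Q" using Z by (auto simp: partition_on_def)
    ultimately show ?thesis unfolding QS_def by (auto; metis Int_greatest subset_empty)
  qed
  have "energy E Q = (\<Sum>S\<in>P. energy E (QS S))"
    unfolding energy_def
    by (subst U, subst sum.UNION_disjoint) (use finP finQ dis in \<open>auto simp: QS_def\<close>)
  moreover have "real (card S) * (share E S)\<^sup>2 + real (card (T S)) * (share E (T S) - share E S)\<^sup>2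
      \<le> energy E (QS S)" if "S \<in> P" for S
  proof (rule energy_gain_part)
    show "finite S" using Z(1) fin that by (metis finite_subset partition_onD1 Union_upper)
  qed (use part T that in \<open>auto simp: QS_def\<close>)
  then have "energy E P + (\<Sum>S\<in>P. real (card (T S)) * (share E (T S) - share E S)\<^sup>2)
     \<le> (\<Sum>S\<in>P. energy E (QS S))"
    unfolding energy_def[of E P] sum.distrib[symmetric] by (rule sum_mono)
  ultimately show ?thesis by simp
qed

definition rectangles :: "'a set set \<Rightarrow> ('a \<times> 'a) set set" where
  "rectangles P = (\<lambda>(A, B). A \<times> B) ` (P \<times> P)"

lemma partition_on_rectangles:
  assumes "partition_on V P"
  shows "partition_on (V \<times> V) (rectangles P)"
  unfolding rectangles_def
proof (rule partition_onI)
  show "\<Union>((\<lambda>(A, B). A \<times> B) ` (P \<times> P)) = V \<times> V"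
    using assms by (auto simp: partition_on_def)
next
  show "{} \<notin> (\<lambda>(A, B). A \<times> B) ` (P \<times> P)" using assms
    by (auto simp: partition_on_def eq_commute[of "{}"])
next
  fix p q assume pq: "p \<in> (\<lambda>(A, B). A \<times> B) ` (P \<times> P)" "q \<in> (\<lambda>(A, B). A \<times> B) ` (P \<times> P)" "p \<noteq> q"
  then obtain A B A' B' where *: "A \<in> P" "B \<in> P" "A' \<in> P" "B' \<in> P" "p = A \<times> B" "q = A' \<times> B'"
    by auto
  then have "A \<noteq> A' \<or> B \<noteq> B'" using pq(3) by auto
  then have "A \<inter> A' = {} \<or> B \<inter> B' = {}"
    using * assms by (auto simp: partition_on_def disjoint_def)
  then show "disjnt p q" using * by (auto simp: disjnt_def)
qed

lemma refines_rectangles: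
  assumes "refines V Q P"
  shows "refines (V \<times> V) (rectangles Q) (rectangles P)"
  unfolding refines_def
proof (intro conjI ballI)
  show "partition_on (V \<times> V) (rectangles Q)" "partition_on (V \<times> V) (rectangles P)"
    using assms by (auto simp: refines_def intro: partition_on_rectangles)
next
  fix X assume "X \<in> rectangles Q"
  then obtain A B where AB: "A \<in> Q" "B \<in> Q" "X = A \<times> B" by (auto simp: rectangles_def)
  then obtain A' B' where "A' \<in> P" "B' \<in> P" "A \<subseteq> A'" "B \<subseteq> B'"
    using assms by (meson refines_def)
  then show "\<exists>Y\<in>rectangles P. X \<subseteq> Y"
    using AB by (auto simp: rectangles_def intro!: bexI[of _ "(A', B')"])
qed

section \<open>Cutting a labelled set into equal pieces\<close>

lemma equal_pieces_exist:
  assumes "finite X" "m > 0"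
  shows "\<exists>\<C>. disjoint \<C> \<and> \<Union>\<C> \<subseteq> X \<and> (\<forall>C\<in>\<C>. card C = m) \<and> card (X - \<Union>\<C>) \<le> m"
  using assms(1)
proof (induction "card X" arbitrary: X rule: less_induct)
  case less
  show ?case
  proof (cases "card X \<le> m")
    case True
    then show ?thesis by (intro exI[of _ "{}"]) (auto simp: disjoint_def)
  next
    case False
    then obtain C where C: "C \<subseteq> X" "card C = m" by (meson nat_le_linear obtain_subset_with_card_n)
    have fC: "finite C" using C less.prems finite_subset by blast
    have "card (X - C) < card X"
      using C fC False assms(2) less.prems by (simp add: card_Diff_subset)
    from less.hyps[OF this] less.prems obtain \<C> where \<C>:
      "disjoint \<C>" "\<Union>\<C> \<subseteq> X - C" "\<forall>C\<in>\<C>. card C = m" "card (X - C - \<Union>\<C>) \<le> m" by auto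
    have "disjoint (insert C \<C>)"
      using \<C>(1,2) by (auto simp: disjoint_def)
    moreover have "X - \<Union>(insert C \<C>) = X - C - \<Union>\<C>" by auto
    ultimately show ?thesis using \<C> C
      by (intro exI[of _ "insert C \<C>"]) auto
  qed
qed

text \<open>Cutting fibre by fibre wastes at most \<open>m\<close> elements for each label.\<close>

lemma equal_pieces_of_fibres:
  assumes "finite X" "m > 0"
  shows "\<exists>\<C>. disjoint \<C> \<and> \<Union>\<C> \<subseteq> X \<and> (\<forall>C\<in>\<C>. card C = m \<and> (\<forall>x\<in>C. \<forall>y\<in>C. f x = f y))
     \<and> card (X - \<Union>\<C>) \<le> card (f ` X) * m"
proof -
  define F where "F y = {x \<in> X. f x = y}" for y
  have "\<forall>y. \<exists>\<C>. disjoint \<C> \<and> \<Union>\<C> \<subseteq> F y \<and> (\<forall>C\<in>\<C>. card C = m) \<and> card (F y - \<Union>\<C>) \<le> m"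
    using assms by (intro allI equal_pieces_exist) (auto simp: F_def)
  then obtain c where c: "\<And>y. disjoint (c y)" "\<And>y. \<Union>(c y) \<subseteq> F y" "\<And>y C. C \<in> c y \<Longrightarrow> card C = m"
    "\<And>y. card (F y - \<Union>(c y)) \<le> m"
    by metis
  define \<C> where "\<C> = (\<Union>y\<in>f ` X. c y)"
  have "disjoint \<C>"
  proof (rule disjointI)
    fix A B assume AB: "A \<in> \<C>" "B \<in> \<C>" "A \<noteq> B"
    then obtain y z where yz: "A \<in> c y" "B \<in> c z" by (auto simp: \<C>_def)
    show "A \<inter> B = {}"
    proof (cases "y = z")
      case True then show ?thesis using yz AB c(1)[of y] by (auto simp: disjoint_def)
    next
      case False
      have "A \<subseteq> F y" "B \<subseteq> F z" using yz c(2) by auto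
      then show ?thesis using False by (auto simp: F_def)
    qed
  qed
  moreover have "\<Union>\<C> \<subseteq> X" using c(2) by (auto simp: \<C>_def F_def)
  moreover have "card C = m \<and> (\<forall>x\<in>C. \<forall>y\<in>C. f x = f y)" if "C \<in> \<C>" for C
  proof -
    from that obtain y where y: "C \<in> c y" by (auto simp: \<C>_def)
    then have "C \<subseteq> F y" using c(2) by auto
    then show ?thesis using c(3)[OF y] by (auto simp: F_def)
  qed
  moreover have "card (X - \<Union>\<C>) \<le> card (f ` X) * m"
  proof -
    have "X - \<Union>\<C> \<subseteq> (\<Union>y\<in>f ` X. F y - \<Union>(c y))"
      by (auto simp: \<C>_def F_def)
    then have "card (X - \<Union>\<C>) \<le> card (\<Union>y\<in>f ` X. F y - \<Union>(c y))"
      using assms by (intro card_mono) (auto simp: F_def)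
    also have "\<dots> \<le> (\<Sum>y\<in>f ` X. card (F y - \<Union>(c y)))"
      using assms by (intro card_UN_le) auto
    also have "\<dots> \<le> (\<Sum>y\<in>f ` X. m)" by (rule sum_mono) (use c in auto)
    finally show ?thesis by simp
  qed
  ultimately show ?thesis by (intro exI[of _ \<C>]) blast
qed

section \<open>Regularity for relations of bounded degree\<close>

definition uniform_pair :: "real \<Rightarrow> ('a \<times> 'a) set \<Rightarrow> 'a set \<Rightarrow> 'a set \<Rightarrow> bool" where
  "uniform_pair \<epsilon> E A B \<longleftrightarrow> (\<forall>U W. U \<subseteq> A \<longrightarrow> W \<subseteq> B \<longrightarrow>
     \<epsilon> * real (card A) \<le> real (card U) \<longrightarrow> \<epsilon> * real (card B) \<le> real (card W) \<longrightarrow>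
     \<bar>share E (A \<times> B) - share E (U \<times> W)\<bar> < \<epsilon>)"

text \<open>Only pairs of share at least \<open>d\<close> are recorded: sparse pairs are lost in any case, and a cluster may
  have unboundedly many sparse partners.\<close>

definition irregular_pairs :: "real \<Rightarrow> real \<Rightarrow> ('a \<times> 'a) set \<Rightarrow> 'a set set \<Rightarrow> ('a set \<times> 'a set) set" where
  "irregular_pairs \<epsilon> d E \<C> =
     {(A, B). A \<in> \<C> \<and> B \<in> \<C> \<and> d \<le> share E (A \<times> B) \<and> \<not> uniform_pair \<epsilon> E A B}"

text \<open>Keeping uncovered vertices as singletons makes a full partition, so that energy never decreases
  when vertices drop out of the clusters.\<close>

definition with_singletons :: "'a set \<Rightarrow> 'a set set \<Rightarrow> 'a set set" where
  "with_singletons V \<C> = \<C> \<union> (\<lambda>v. {v}) ` (V - \<Union>\<C>)"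

lemma partition_on_with_singletons:
  assumes "disjoint \<C>" "\<Union>\<C> \<subseteq> V" "{} \<notin> \<C>"
  shows "partition_on V (with_singletons V \<C>)"
  using assms by (auto simp: partition_on_def with_singletons_def disjoint_def)

lemma share_converse_sym:
  assumes "sym E"
  shows "share E (A \<times> B) = share E (B \<times> A)"
proof -
  have "bij_betw prod.swap (E \<inter> A \<times> B) (E \<inter> B \<times> A)"
    using assms by (intro bij_betwI[where g = prod.swap]) (auto simp: sym_def)
  then have "card (E \<inter> A \<times> B) = card (E \<inter> B \<times> A)" by (rule bij_betw_same_card)
  then show ?thesis by (simp add: share_def card_cartesian_product mult.commute)
qed

lemma card_Int_Times_le:
  assumes "finite A" "E \<subseteq> V \<times> V" "finite V" "\<And>x. real (card (E `` {x})) \<le> M"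
  shows "real (card (E \<inter> A \<times> V)) \<le> real (card A) * M"
proof -
  have finE: "finite E" using assms finite_subset by blast
  have "E \<inter> A \<times> V = Sigma A (\<lambda>x. E `` {x})" using assms(2) by auto
  then have "real (card (E \<inter> A \<times> V)) = (\<Sum>x\<in>A. real (card (E `` {x})))"
    using assms(1) finE by (simp add: card_SigmaI finite_Image)
  also have "\<dots> \<le> (\<Sum>x\<in>A. M)" by (rule sum_mono) (rule assms)
  finally show ?thesis by simp
qed

text \<open>Each dense partner absorbs at least \<open>dm\<^sup>2\<close> of the at most \<open>mM\<close> related pairs that start in \<open>C\<close>.\<close>

lemma card_dense_partners:
  assumes V: "finite V" "E \<subseteq> V \<times> V" "\<And>x. real (card (E `` {x})) \<le> M"
    and \<C>: "disjoint \<C>" "\<Union>\<C> \<subseteq> V" "\<And>C. C \<in> \<C> \<Longrightarrow> card C = m"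
    and m: "m > 0" "d > 0" "M \<le> d * real m * real K"
    and C: "C \<in> \<C>"
  shows "card {B \<in> \<C>. d \<le> share E (C \<times> B)} \<le> K"
proof -
  define N where "N = {B \<in> \<C>. d \<le> share E (C \<times> B)}"
  have fin\<C>: "finite \<C>" using V(1) \<C>(2) by (metis finite_UnionD finite_subset)
  have fin: "finite B" if "B \<in> \<C>" for B using that V(1) \<C>(2) by (meson Union_upper finite_subset)
  have "real (card N) * (d * (real m * real m)) = (\<Sum>B\<in>N. d * (real m * real m))" by simp
  also have "\<dots> \<le> (\<Sum>B\<in>N. real (card (E \<inter> C \<times> B)))"
  proof (rule sum_mono)
    fix B assume B: "B \<in> N"
    then have "d * real (card (C \<times> B)) \<le> share E (C \<times> B) * real (card (C \<times> B))"
      by (intro mult_right_mono) (auto simp: N_def)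
    also have "\<dots> = real (card (E \<inter> C \<times> B))"
      using card_times_share[of "C \<times> B" E] fin C B by (simp add: N_def mult.commute)
    finally show "d * (real m * real m) \<le> real (card (E \<inter> C \<times> B))"
      using B C \<C>(3) by (simp add: card_cartesian_product N_def)
  qed
  also have "\<dots> = real (card (\<Union>B\<in>N. E \<inter> C \<times> B))"
  proof -
    have "card (\<Union>B\<in>N. E \<inter> C \<times> B) = (\<Sum>B\<in>N. card (E \<inter> C \<times> B))"
      using fin\<C> fin C \<C>(1) by (intro card_UN_disjoint) (auto simp: N_def disjoint_def)
    then show ?thesis by simp
  qed
  also have "\<dots> \<le> real (card (E \<inter> C \<times> V))"
    using V \<C>(2) finite_subset[OF V(2)] by (intro of_nat_mono card_mono) (auto simp: N_def)
  also have "\<dots> \<le> real (card C) * M"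
    using card_Int_Times_le[OF fin[OF C] V(2,1,3)] .
  also have "\<dots> \<le> real m * (d * real m * real K)"
    using m C \<C>(3) by (simp add: mult_left_mono)
  finally have "real (card N) * (d * (real m * real m)) \<le> real K * (d * (real m * real m))"
    by (simp add: mult_ac)
  moreover have "d * (real m * real m) > 0" using m by simp
  ultimately have "real (card N) \<le> real K" by (simp only: mult_le_cancel_right_pos)
  then show ?thesis by (simp add: N_def)
qed

lemma irregularity_gain:
  assumes "\<epsilon> > 0"
    and U: "U \<subseteq> A" "\<epsilon> * real (card A) \<le> real (card U)"
    and W: "W \<subseteq> B" "\<epsilon> * real (card B) \<le> real (card W)"
    and far: "\<bar>share E (A \<times> B) - share E (U \<times> W)\<bar> \<ge> \<epsilon>"
  shows "\<epsilon> ^ 4 * (real (card A) * real (card B))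
    \<le> real (card (U \<times> W)) * (share E (U \<times> W) - share E (A \<times> B))\<^sup>2"
proof -
  have 1: "\<epsilon>\<^sup>2 \<le> (share E (U \<times> W) - share E (A \<times> B))\<^sup>2"
    using far \<open>\<epsilon> > 0\<close> by (metis abs_le_square_iff abs_minus_commute abs_of_pos)
  have 2: "(\<epsilon> * real (card A)) * (\<epsilon> * real (card B)) \<le> real (card U) * real (card W)"
    using U W \<open>\<epsilon> > 0\<close> by (intro mult_mono) auto
  have "\<epsilon> ^ 4 * (real (card A) * real (card B)) = ((\<epsilon> * real (card A)) * (\<epsilon> * real (card B))) * \<epsilon>\<^sup>2"
    by (simp add: power2_eq_square power4_eq_xxxx mult_ac)
  also have "\<dots> \<le> (real (card U) * real (card W)) * (share E (U \<times> W) - share E (A \<times> B))\<^sup>2"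
    by (rule mult_mono[OF 2 1]) auto
  finally show ?thesis by (simp add: card_cartesian_product)
qed

text \<open>One round of the energy increment argument. A cluster \<open>C\<close> is cut by the witnesses of irregularity
  of all dense pairs in which it occurs, on either side. It has at most \<open>K\<close> dense partners, hence at
  most \<open>2K\<close> witnesses and \<open>4\<^sup>K\<close> cells, and the cells are then chopped to a common size \<open>m'\<close>.\<close>

lemma regularity_step:
  assumes V: "finite V" "E \<subseteq> V \<times> V" "sym E" "\<And>x. real (card (E `` {x})) \<le> M"
    and \<C>: "disjoint \<C>" "\<Union>\<C> \<subseteq> V" "\<forall>C\<in>\<C>. card C = m"
    and m: "m > 0" "d > 0" "M \<le> d * real m * real K" "\<epsilon> > 0" "m' > 0"
  shows "\<exists>\<C>'. disjoint \<C>' \<and> (\<forall>C'\<in>\<C>'. card C' = m' \<and> (\<exists>C\<in>\<C>. C' \<subseteq> C)) \<and>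
      card (\<Union>\<C> - \<Union>\<C>') \<le> card \<C> * 4 ^ K * m' \<and>
      energy E (rectangles (with_singletons V \<C>)) +
        \<epsilon> ^ 4 * (\<Sum>(A, B)\<in>irregular_pairs \<epsilon> d E \<C>. real (card A) * real (card B))
      \<le> energy E (rectangles (with_singletons V \<C>'))"
proof -
  define I where "I = irregular_pairs \<epsilon> d E \<C>"
  have fin\<C>: "finite \<C>" using V(1) \<C>(2) by (metis finite_UnionD finite_subset)
  have finC: "finite B" if "B \<in> \<C>" for B using that V(1) \<C>(2) by (meson Union_upper finite_subset)
  have ne: "{} \<notin> \<C>" using \<C>(3) m(1) by fastforce
  have finI: "finite I"
    by (rule finite_subset[of _ "\<C> \<times> \<C>"]) (use fin\<C> in \<open>auto simp: I_def irregular_pairs_def\<close>)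
  have "\<forall>p\<in>I. \<exists>U W. U \<subseteq> fst p \<and> W \<subseteq> snd p \<and>
     \<epsilon> * real (card (fst p)) \<le> real (card U) \<and> \<epsilon> * real (card (snd p)) \<le> real (card W) \<and>
     \<bar>share E (fst p \<times> snd p) - share E (U \<times> W)\<bar> \<ge> \<epsilon>"
    by (auto simp: I_def irregular_pairs_def uniform_pair_def not_less)
  then obtain Uf Wf where UW: "\<And>p. p \<in> I \<Longrightarrow> Uf p \<subseteq> fst p" "\<And>p. p \<in> I \<Longrightarrow> Wf p \<subseteq> snd p"
     "\<And>p. p \<in> I \<Longrightarrow> \<epsilon> * real (card (fst p)) \<le> real (card (Uf p))"
     "\<And>p. p \<in> I \<Longrightarrow> \<epsilon> * real (card (snd p)) \<le> real (card (Wf p))"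
     "\<And>p. p \<in> I \<Longrightarrow> \<bar>share E (fst p \<times> snd p) - share E (Uf p \<times> Wf p)\<bar> \<ge> \<epsilon>"
    by metis
  define wit where "wit C = Uf ` {p \<in> I. fst p = C} \<union> Wf ` {p \<in> I. snd p = C}" for C
  have finwit: "finite (wit C)" for C using finI by (simp add: wit_def)
  have card_wit: "card (wit C) \<le> 2 * K" if C: "C \<in> \<C>" for C
  proof -
    define N where "N = {B \<in> \<C>. d \<le> share E (C \<times> B)}"
    have N: "card N \<le> K" "finite N"
      using card_dense_partners[OF V(1,2,4) \<C>(1,2) _ m(1,2,3) C] \<C>(3) fin\<C> by (auto simp: N_def)
    have "{p \<in> I. fst p = C} \<subseteq> {C} \<times> N"
      by (auto simp: N_def I_def irregular_pairs_def)
    then have "card {p \<in> I. fst p = C} \<le> card ({C} \<times> N)" by (rule card_mono[rotated]) (use N in auto)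
    then have 1: "card {p \<in> I. fst p = C} \<le> K" using N by (simp add: card_cartesian_product)
    have "{p \<in> I. snd p = C} \<subseteq> N \<times> {C}"
      using share_converse_sym[OF V(3), of C] by (auto simp: N_def I_def irregular_pairs_def)
    then have "card {p \<in> I. snd p = C} \<le> card (N \<times> {C})" by (rule card_mono[rotated]) (use N in auto)
    then have 2: "card {p \<in> I. snd p = C} \<le> K" using N by (simp add: card_cartesian_product)
    have "card (wit C) \<le> card (Uf ` {p \<in> I. fst p = C}) + card (Wf ` {p \<in> I. snd p = C})"
      by (simp add: wit_def card_Un_le)
    also have "\<dots> \<le> card {p \<in> I. fst p = C} + card {p \<in> I. snd p = C}"
      using finI by (intro add_mono card_image_le) auto
    finally show ?thesis using 1 2 by simp
  qed
  \<comment> \<open>The second component is the cell of \<open>x\<close> in the Venn diagram of the witnesses for its own cluster;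
      an empty witness, which lies in every cluster, has to be tied to the right one.\<close>
  define lab where "lab x = ({C \<in> \<C>. x \<in> C}, {S. x \<in> S \<and> (\<exists>C\<in>\<C>. x \<in> C \<and> S \<in> wit C)})" for x
  have lab: "lab x = ({C}, {S \<in> wit C. x \<in> S})" if "C \<in> \<C>" "x \<in> C" for C x
    
  proof -
    have "D = C" if "D \<in> \<C>" "x \<in> D" for D
      using that \<open>C \<in> \<C>\<close> \<open>x \<in> C\<close> \<C>(1) by (auto simp: disjoint_def)
    then show ?thesis using that unfolding lab_def by blast
  qed
  have finX: "finite (\<Union>\<C>)" by (rule finite_subset[OF \<C>(2) V(1)])
  have card_lab: "card (lab ` \<Union>\<C>) \<le> card \<C> * 4 ^ K"
  proof -
    have "lab ` \<Union>\<C> \<subseteq> (\<Union>C\<in>\<C>. {{C}} \<times> Pow (wit C))"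
    proof
      fix y assume "y \<in> lab ` \<Union>\<C>"
      then obtain x C where "y = lab x" "x \<in> C" "C \<in> \<C>" by blast
      then show "y \<in> (\<Union>C\<in>\<C>. {{C}} \<times> Pow (wit C))" using lab[of C x] by auto
    qed
    then have "card (lab ` \<Union>\<C>) \<le> card (\<Union>C\<in>\<C>. {{C}} \<times> Pow (wit C))"
      by (rule card_mono[rotated]) (use fin\<C> finwit in auto)
    also have "\<dots> \<le> (\<Sum>C\<in>\<C>. card ({{C}} \<times> Pow (wit C)))"
      by (rule card_UN_le[OF fin\<C>])
    also have "\<dots> \<le> (\<Sum>C\<in>\<C>. 4 ^ K)"
    proof (rule sum_mono)
      fix C assume "C \<in> \<C>"
      have "card ({{C}} \<times> Pow (wit C)) = 2 ^ card (wit C)"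
        using finwit by (simp add: card_cartesian_product card_Pow)
      also have "\<dots> \<le> 2 ^ (2 * K)" by (rule power_increasing) (use card_wit[OF \<open>C \<in> \<C>\<close>] in auto)
      finally show "card ({{C}} \<times> Pow (wit C)) \<le> 4 ^ K" by (simp add: power_mult)
    qed
    finally show ?thesis by simp
  qed
  obtain \<C>' where \<C>': "disjoint \<C>'" "\<Union>\<C>' \<subseteq> \<Union>\<C>"
    "\<And>C. C \<in> \<C>' \<Longrightarrow> card C = m'" "\<And>C x y. C \<in> \<C>' \<Longrightarrow> x \<in> C \<Longrightarrow> y \<in> C \<Longrightarrow> lab x = lab y"
    "card (\<Union>\<C> - \<Union>\<C>') \<le> card (lab ` \<Union>\<C>) * m'"
    using equal_pieces_of_fibres[OF finX m(5), of lab] by (elim exE conjE) blast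
  have ne': "{} \<notin> \<C>'" using \<C>'(3) m(5) by fastforce
  have sub: "\<exists>C\<in>\<C>. C' \<subseteq> C" if C': "C' \<in> \<C>'" for C'
  proof -
    obtain x where x: "x \<in> C'" using C' ne' by fastforce
    then obtain C where C: "C \<in> \<C>" "x \<in> C" using \<C>'(2) C' by blast
    have "y \<in> C" if "y \<in> C'" for y
    proof -
      have "lab y = lab x" using \<C>'(4) C' x that by blast
      then have "{D \<in> \<C>. y \<in> D} = {C}" using lab[OF C] by (simp add: lab_def)
      then show ?thesis by blast
    qed
    then show ?thesis using C by blast
  qed
  have whole: "C' \<subseteq> S \<or> C' \<inter> S = {}" if C': "C' \<in> \<C>'" and S: "S \<in> wit C" "S \<subseteq> C" "C \<in> \<C>" for C' S C
  proof (rule ccontr)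
    assume "\<not> ?thesis"
    then obtain x y where xy: "x \<in> C'" "x \<notin> S" "y \<in> C'" "y \<in> S" by blast
    then have "lab x = lab y" using \<C>'(4) C' by blast
    moreover have "S \<in> snd (lab y)" using xy S by (auto simp: lab_def)
    moreover have "S \<notin> snd (lab x)" using xy by (auto simp: lab_def)
    ultimately show False by simp
  qed
  let ?P = "with_singletons V \<C>" and ?Q = "with_singletons V \<C>'"
  have pP: "partition_on V ?P" using partition_on_with_singletons[OF \<C>(1,2) ne] .
  have pQ: "partition_on V ?Q" using partition_on_with_singletons[OF \<C>'(1) _ ne'] \<C>'(2) \<C>(2) by blast
  have "refines V ?Q ?P"
    unfolding refines_def
  proof (intro conjI ballI pP pQ)
    fix X assume "X \<in> ?Q"
    then consider "X \<in> \<C>'" | v where "v \<in> V" "X = {v}" by (auto simp: with_singletons_def)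
    then show "\<exists>Y\<in>?P. X \<subseteq> Y"
    proof cases
      case 1 then show ?thesis using sub[of X] unfolding with_singletons_def by blast
    next
      case 2 then show ?thesis using pP by (auto simp: partition_on_def)
    qed
  qed
  then have ref: "refines (V \<times> V) (rectangles ?Q) (rectangles ?P)" by (rule refines_rectangles)
  \<comment> \<open>A rectangle with non-empty sides determines its sides as its projections.\<close>
  define T where "T S = (let p = (fst ` S, snd ` S) in if p \<in> I then Uf p \<times> Wf p else S)" for S
  have I\<C>: "fst p \<in> \<C> \<and> snd p \<in> \<C>" if "p \<in> I" for p
    using that by (auto simp: I_def irregular_pairs_def)
  have T_I: "T (A \<times> B) = Uf (A, B) \<times> Wf (A, B)" if "(A, B) \<in> I" for A B
  proof -
    have "A \<noteq> {}" "B \<noteq> {}" using I\<C>[OF that] ne by auto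
    then show ?thesis using that by (simp add: T_def Let_def fst_image_times snd_image_times)
  qed
  have dichotomy: "X \<subseteq> S \<or> X \<inter> S = {}" if "X \<in> ?Q" "S \<in> wit C" "S \<subseteq> C" "C \<in> \<C>" for X S C
    using that whole[of X S C] by (auto simp: with_singletons_def)
  have T_eq: "\<exists>A B. S = A \<times> B \<and> A \<in> ?P \<and> B \<in> ?P \<and>
      (if (A, B) \<in> I then T S = Uf (A, B) \<times> Wf (A, B) else T S = S)" if S: "S \<in> rectangles ?P" for S
  proof -
    obtain A B where AB: "A \<in> ?P" "B \<in> ?P" "S = A \<times> B" using S by (auto simp: rectangles_def)
    then have "A \<noteq> {}" "B \<noteq> {}" using pP by (auto simp: partition_on_def)
    then show ?thesis using AB by (intro exI[of _ A] exI[of _ B]) (auto simp: T_def Let_def fst_image_times snd_image_times)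
  qed
  have gain: "energy E (rectangles ?P)
      + (\<Sum>S\<in>rectangles ?P. real (card (T S)) * (share E (T S) - share E S)\<^sup>2)
      \<le> energy E (rectangles ?Q)"
  proof (rule energy_gain[OF _ ref])
    show "finite (V \<times> V)" using V by simp
  next
    fix S assume S: "S \<in> rectangles ?P"
    from T_eq[OF this] obtain A B where AB: "S = A \<times> B" "A \<in> ?P" "B \<in> ?P"
      "if (A, B) \<in> I then T S = Uf (A, B) \<times> Wf (A, B) else T S = S" by blast
    then show "T S \<subseteq> S" using UW(1,2)[of "(A, B)"] by (auto split: if_splits)
    fix R assume "R \<in> rectangles ?Q"
    then obtain X Y where XY: "X \<in> ?Q" "Y \<in> ?Q" "R = X \<times> Y" by (auto simp: rectangles_def)
    show "R \<subseteq> T S \<or> R \<inter> T S = {}"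
    proof (cases "(A, B) \<in> I")
      case True
      have "X \<subseteq> Uf (A, B) \<or> X \<inter> Uf (A, B) = {}"
        by (rule dichotomy[of _ _ A]) (use XY True UW(1)[OF True] I\<C>[OF True] in \<open>auto simp: wit_def\<close>)
      moreover have "Y \<subseteq> Wf (A, B) \<or> Y \<inter> Wf (A, B) = {}"
        by (rule dichotomy[of _ _ B]) (use XY True UW(2)[OF True] I\<C>[OF True] in \<open>auto simp: wit_def\<close>)
      ultimately show ?thesis using AB XY True by auto
    next
      case False
      then have "T S = S" using AB by simp
      obtain R' where R': "R' \<in> rectangles ?P" "R \<subseteq> R'"
        using ref \<open>R \<in> rectangles ?Q\<close> by (auto simp: refines_def)
      have "R' = S \<or> R' \<inter> S = {}"
        using ref R'(1) S unfolding refines_def partition_on_def disjoint_def by blast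
      then show ?thesis using \<open>T S = S\<close> R' by blast
    qed
  qed
  have "\<epsilon> ^ 4 * (\<Sum>(A, B)\<in>I. real (card A) * real (card B))
      \<le> (\<Sum>p\<in>I. real (card (T (fst p \<times> snd p))) *
            (share E (T (fst p \<times> snd p)) - share E (fst p \<times> snd p))\<^sup>2)"
    unfolding sum_distrib_left
  proof (rule sum_mono, clarify)
    fix A B assume AB: "(A, B) \<in> I"
    have "\<epsilon> ^ 4 * (real (card A) * real (card B)) \<le> real (card (Uf (A, B) \<times> Wf (A, B))) *
            (share E (Uf (A, B) \<times> Wf (A, B)) - share E (A \<times> B))\<^sup>2"
      using UW[OF AB] m(4) by (intro irregularity_gain) auto
    then show "\<epsilon> ^ 4 * (real (card A) * real (card B)) \<le> real (card (T (fst (A, B) \<times> snd (A, B)))) *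
            (share E (T (fst (A, B) \<times> snd (A, B))) - share E (fst (A, B) \<times> snd (A, B)))\<^sup>2"
      by (simp add: T_I[OF AB])
  qed
  also have "\<dots> = (\<Sum>S\<in>(\<lambda>p. fst p \<times> snd p) ` I. real (card (T S)) * (share E (T S) - share E S)\<^sup>2)"
  proof (subst sum.reindex)
    show "inj_on (\<lambda>p. fst p \<times> snd p) I"
    proof (rule inj_onI)
      fix p q assume pq: "p \<in> I" "q \<in> I" "fst p \<times> snd p = fst q \<times> snd q"
      then have "fst p \<noteq> {}" "snd p \<noteq> {}" "fst q \<noteq> {}" "snd q \<noteq> {}" using I\<C> ne by metis+
      then show "p = q" using pq(3) by (simp add: times_eq_iff prod_eq_iff)
    qed
  qed simp
  also have "\<dots> \<le> (\<Sum>S\<in>rectangles ?P. real (card (T S)) * (share E (T S) - share E S)\<^sup>2)"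
  proof (rule sum_mono2)
    show "finite (rectangles ?P)"
      using finite_elements[OF V(1) pP] by (simp add: rectangles_def)
    show "(\<lambda>p. fst p \<times> snd p) ` I \<subseteq> rectangles ?P"
      using I\<C> by (force simp: rectangles_def with_singletons_def)
  qed simp
  finally have "energy E (rectangles ?P) + \<epsilon> ^ 4 * (\<Sum>(A, B)\<in>I. real (card A) * real (card B))
      \<le> energy E (rectangles ?Q)" using gain by linarith
  moreover have "card (\<Union>\<C> - \<Union>\<C>') \<le> card \<C> * 4 ^ K * m'"
    using \<C>'(5) card_lab by (meson le_trans mult_le_mono1)
  ultimately show ?thesis
    using \<C>'(1,3) sub unfolding I_def by (intro exI[of _ \<C>']) blast
qed

definition equal_clusters :: "'a set \<Rightarrow> ('a \<Rightarrow> 'b) \<Rightarrow> nat \<Rightarrow> 'a set set \<Rightarrow> bool" where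
  "equal_clusters Y f m \<C> \<longleftrightarrow> m > 0 \<and> disjoint \<C> \<and> \<Union>\<C> \<subseteq> Y \<and>
     (\<forall>C\<in>\<C>. card C = m \<and> (\<forall>x\<in>C. \<forall>y\<in>C. f x = f y))"

definition bounded_relation :: "real \<Rightarrow> 'a set \<Rightarrow> ('a \<times> 'a) set \<Rightarrow> bool" where
  "bounded_relation M V E \<longleftrightarrow>
     finite V \<and> E \<subseteq> V \<times> V \<and> sym E \<and> (\<forall>x. real (card (E `` {x})) \<le> M)"

definition irregular_mass :: "real \<Rightarrow> real \<Rightarrow> ('a \<times> 'a) set \<Rightarrow> 'a set set \<Rightarrow> real" where
  "irregular_mass \<epsilon> d E \<C> = (\<Sum>(A, B)\<in>irregular_pairs \<epsilon> d E \<C>. real (card (E \<inter> A \<times> B)))"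

definition cluster_energy :: "'a set \<Rightarrow> ('a \<times> 'a) set \<Rightarrow> 'a set set \<Rightarrow> real" where
  "cluster_energy V E \<C> = energy E (rectangles (with_singletons V \<C>))"

lemma nat_floor_bounds:
  assumes "x \<ge> (1::real)"
  shows "nat \<lfloor>x\<rfloor> > 0" "x / 2 \<le> real (nat \<lfloor>x\<rfloor>)" "real (nat \<lfloor>x\<rfloor>) \<le> x"
proof -
  have eq: "real (nat \<lfloor>x\<rfloor>) = of_int \<lfloor>x\<rfloor>" using assms by simp
  have "1 \<le> \<lfloor>x\<rfloor>" using assms by simp
  then have one: "1 \<le> real_of_int \<lfloor>x\<rfloor>" by linarith
  show "nat \<lfloor>x\<rfloor> > 0" using assms by simp
  show "x / 2 \<le> real (nat \<lfloor>x\<rfloor>)" unfolding eq using one by linarith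
  show "real (nat \<lfloor>x\<rfloor>) \<le> x" unfolding eq by linarith
qed

text \<open>Each label leaves at most \<open>m\<close> vertices over, and there are at most \<open>n/(tk)\<close> labels, so \<open>m\<close> is
  chosen as a small multiple of \<open>tk\<close>.\<close>

lemma initial_clusters:
  assumes "t > 0" "\<mu> > 0" "\<tau> > 0"
  shows "\<exists>\<nu>>0. \<exists>k0::nat. \<forall>k\<ge>k0. \<forall>V Y. \<forall>f :: 'a \<Rightarrow> 'b. finite V \<longrightarrow> Y \<subseteq> V \<longrightarrow>
    real (card (f ` Y)) * (t * real k) \<le> real (card V) \<longrightarrow>
    (\<exists>\<C> m. equal_clusters Y f m \<C> \<and> \<nu> * real k \<le> real m \<and> real m \<le> \<mu> * real k \<and>
       real (card (Y - \<Union>\<C>)) \<le> \<tau> * real (card V))"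
proof -
  define c where "c = min (\<tau> * t) \<mu>"
  have c: "c > 0" "c \<le> \<tau> * t" "c \<le> \<mu>" using assms by (auto simp: c_def)
  define k0 where "k0 = nat \<lceil>1 / c\<rceil>"
  show ?thesis
  proof (rule exI[of _ "c / 2"], intro conjI exI[of _ k0] allI impI)
    show "c / 2 > 0" using c by simp
    fix k :: nat and V Y :: "'a set" and f :: "'a \<Rightarrow> 'b"
    assume k: "k0 \<le> k" and V: "finite V" "Y \<subseteq> V"
      and f: "real (card (f ` Y)) * (t * real k) \<le> real (card V)"
    have "1 / c \<le> real k" using k unfolding k0_def by linarith
    then have ck: "1 \<le> c * real k" using c by (simp add: divide_le_eq mult.commute)
    define m where "m = nat \<lfloor>c * real k\<rfloor>"
    note m = nat_floor_bounds[OF ck, folded m_def]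
    have finY: "finite Y" using V finite_subset by blast
    obtain \<C> where \<C>: "disjoint \<C>" "\<Union>\<C> \<subseteq> Y"
      "\<forall>C\<in>\<C>. card C = m \<and> (\<forall>x\<in>C. \<forall>y\<in>C. f x = f y)" "card (Y - \<Union>\<C>) \<le> card (f ` Y) * m"
      using equal_pieces_of_fibres[OF finY m(1), of f] by (elim exE conjE) blast
    have "real (card (Y - \<Union>\<C>)) \<le> real (card (f ` Y)) * real m"
      using \<C>(4) by (metis of_nat_mult of_nat_mono)
    also have "\<dots> \<le> real (card (f ` Y)) * (c * real k)"
      using m by (intro mult_left_mono) auto
    also have "\<dots> \<le> real (card (f ` Y)) * (\<tau> * t * real k)"
      using c by (intro mult_left_mono mult_right_mono) auto
    also have "\<dots> = \<tau> * (real (card (f ` Y)) * (t * real k))" by simp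
    also have "\<dots> \<le> \<tau> * real (card V)" using f assms by (intro mult_left_mono) auto
    finally have left: "real (card (Y - \<Union>\<C>)) \<le> \<tau> * real (card V)" .
    have "real m \<le> \<mu> * real k"
      using m(3) c(3) by (meson mult_right_mono of_nat_0_le_iff order_trans)
    moreover have "equal_clusters Y f m \<C>"
      unfolding equal_clusters_def using \<C>(1-3) m(1) by blast
    moreover have "c / 2 * real k \<le> real m" using m(2) by simp
    ultimately show "\<exists>\<C> m. equal_clusters Y f m \<C> \<and> c / 2 * real k \<le> real m \<and> real m \<le> \<mu> * real k \<and>
       real (card (Y - \<Union>\<C>)) \<le> \<tau> * real (card V)"
      using left by blast
  qed
qed

lemma energy_le_degree:
  assumes V: "finite V" "E \<subseteq> V \<times> V" "\<And>x. real (card (E `` {x})) \<le> M"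
    and \<C>: "equal_clusters Y f m \<C>" "Y \<subseteq> V"
  shows "energy E (rectangles (with_singletons V \<C>)) \<le> real (card V) * M"
proof -
  have "{} \<notin> \<C>" using \<C>(1) by (fastforce simp: equal_clusters_def)
  then have "partition_on V (with_singletons V \<C>)"
    using \<C> by (intro partition_on_with_singletons) (auto simp: equal_clusters_def)
  then have "energy E (rectangles (with_singletons V \<C>)) \<le> real (card (E \<inter> V \<times> V))"
    using V(1) by (intro energy_le_card partition_on_rectangles) auto
  also have "\<dots> \<le> real (card V) * M" by (rule card_Int_Times_le[OF V(1,2,1,3)])
  finally show ?thesis .
qed

text \<open>The quantitative form of \<open>regularity_step\<close>: all constants depend on \<open>\<nu>\<close> but not on the relation,
  which is what allows the step to be iterated. The hypothesis on the irregular mass turns into an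
  energy gain because a pair \<open>(A, B)\<close> carries at most \<open>|A||B|\<close> related pairs.\<close>

lemma refine_clusters:
  fixes \<nu> \<tau> :: real
  assumes "\<epsilon> > 0" "\<eta> > 0" "d > 0" "\<nu> > 0" "\<tau> > 0" "\<tau> \<le> 1"
  shows "\<exists>\<nu>'>0. \<exists>k0::nat. \<forall>k\<ge>k0. \<forall>V E Y. \<forall>f :: 'a \<Rightarrow> 'b. \<forall>\<C> m.
    bounded_relation (\<omega> * real k) V E \<longrightarrow> Y \<subseteq> V \<longrightarrow>
    equal_clusters Y f m \<C> \<longrightarrow> \<nu> * real k \<le> real m \<longrightarrow>
    \<eta> * real k * real (card V) < irregular_mass \<epsilon> d E \<C> \<longrightarrow>
    (\<exists>\<C>' m'. equal_clusters Y f m' \<C>' \<and> \<nu>' * real k \<le> real m' \<and> m' \<le> m \<and>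
       real (card (Y - \<Union>\<C>')) \<le> real (card (Y - \<Union>\<C>)) + \<tau> * real (card V) \<and>
       cluster_energy V E \<C> + \<epsilon> ^ 4 * \<eta> * real k * real (card V)
         \<le> cluster_energy V E \<C>')"
proof -
  \<comment> \<open>The bound on the number of dense partners of a cluster of size at least \<open>\<nu>k\<close>.\<close>
  define K where "K = nat \<lceil>\<omega> / (d * \<nu>)\<rceil>"
  \<comment> \<open>Pieces of size \<open>cm\<close> leave at most \<open>4\<^sup>K\<close> times \<open>cm\<close>, that is \<open>\<tau>m\<close>, vertices of each cluster over.\<close>
  define c where "c = \<tau> / 4 ^ K"
  have c: "c > 0" "c \<le> 1" using assms by (auto simp: c_def divide_le_eq intro: order_trans[OF _ one_le_power])
  define k0 where "k0 = nat \<lceil>1 / (c * \<nu>)\<rceil>"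
  show ?thesis
  proof (rule exI[of _ "c * \<nu> / 2"], intro conjI exI[of _ k0] allI impI)
    show "c * \<nu> / 2 > 0" using c assms by simp
    fix k m :: nat and V Y :: "'a set" and f :: "'a \<Rightarrow> 'b" and \<C> E
    assume k: "k0 \<le> k" and E: "bounded_relation (\<omega> * real k) V E" and Y: "Y \<subseteq> V"
      and \<C>: "equal_clusters Y f m \<C>" and m: "\<nu> * real k \<le> real m"
      and bad: "\<eta> * real k * real (card V) < irregular_mass \<epsilon> d E \<C>"
    have V: "finite V" "E \<subseteq> V \<times> V" "sym E"
      and deg: "\<And>x. real (card (E `` {x})) \<le> \<omega> * real k"
      using E unfolding bounded_relation_def by blast+
    have finY: "finite Y" by (rule finite_subset[OF Y V(1)])
    have \<C>': "m > 0" "disjoint \<C>" "\<Union>\<C> \<subseteq> Y" "\<forall>C\<in>\<C>. card C = m"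
      "\<And>C x y. C \<in> \<C> \<Longrightarrow> x \<in> C \<Longrightarrow> y \<in> C \<Longrightarrow> f x = f y"
      using \<C> unfolding equal_clusters_def by blast+
    have "1 / (c * \<nu>) \<le> real k" using k unfolding k0_def by linarith
    then have "1 \<le> c * (\<nu> * real k)" using c assms by (simp add: divide_le_eq mult_ac)
    also have "\<dots> \<le> c * real m" using m c by (intro mult_left_mono) auto
    finally have cm: "1 \<le> c * real m" .
    define m' where "m' = nat \<lfloor>c * real m\<rfloor>"
    note m' = nat_floor_bounds[OF cm, folded m'_def]
    have "\<omega> / (d * \<nu>) \<le> real K" unfolding K_def by linarith
    then have "\<omega> \<le> d * \<nu> * real K" using assms by (simp add: divide_le_eq mult_ac)
    then have "\<omega> * real k \<le> d * \<nu> * real K * real k" by (intro mult_right_mono) auto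
    also have "\<dots> = d * (\<nu> * real k) * real K" by simp
    also have "\<dots> \<le> d * real m * real K"
      using m assms by (intro mult_right_mono mult_left_mono) auto
    finally have K: "\<omega> * real k \<le> d * real m * real K" .
    have \<C>V: "\<Union>\<C> \<subseteq> V" using \<C>'(3) Y by blast
    obtain \<C>1 where \<C>1: "disjoint \<C>1" "\<forall>C'\<in>\<C>1. card C' = m' \<and> (\<exists>C\<in>\<C>. C' \<subseteq> C)"
      "card (\<Union>\<C> - \<Union>\<C>1) \<le> card \<C> * 4 ^ K * m'"
      "cluster_energy V E \<C> +
        \<epsilon> ^ 4 * (\<Sum>(A, B)\<in>irregular_pairs \<epsilon> d E \<C>. real (card A) * real (card B))
      \<le> cluster_energy V E \<C>1"
      unfolding cluster_energy_def using regularity_step[OF V(1,2,3) deg \<C>'(2) \<C>V \<C>'(4,1) \<open>d > 0\<close> K \<open>\<epsilon> > 0\<close> m'(1)]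
      by (elim exE conjE) blast
    have finC: "finite C" if "C \<in> \<C>" for C
      using that \<C>'(3) finY by (meson Union_upper finite_subset order_trans)
    have "\<eta> * real k * real (card V)
       \<le> (\<Sum>(A, B)\<in>irregular_pairs \<epsilon> d E \<C>. real (card A) * real (card B))"
    proof -
      have "irregular_mass \<epsilon> d E \<C>
        \<le> (\<Sum>(A, B)\<in>irregular_pairs \<epsilon> d E \<C>. real (card A) * real (card B))"
        unfolding irregular_mass_def
      proof (rule sum_mono, clarify)
        fix A B assume "(A, B) \<in> irregular_pairs \<epsilon> d E \<C>"
        then have "finite (A \<times> B)" using finC by (auto simp: irregular_pairs_def)
        then have "card (E \<inter> A \<times> B) \<le> card (A \<times> B)" by (intro card_mono) auto
        then show "real (card (E \<inter> A \<times> B)) \<le> real (card A) * real (card B)"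
          by (metis card_cartesian_product of_nat_mono of_nat_mult)
      qed
      then show ?thesis using bad by linarith
    qed
    then have "\<epsilon> ^ 4 * (\<eta> * real k * real (card V))
      \<le> \<epsilon> ^ 4 * (\<Sum>(A, B)\<in>irregular_pairs \<epsilon> d E \<C>. real (card A) * real (card B))"
      using assms by (intro mult_left_mono) auto
    then have gain: "cluster_energy V E \<C> + \<epsilon> ^ 4 * \<eta> * real k * real (card V)
         \<le> cluster_energy V E \<C>1"
      using \<C>1(4) by (simp add: mult.assoc)
    have cl: "equal_clusters Y f m' \<C>1"
    proof -
      have "\<Union>\<C>1 \<subseteq> \<Union>\<C>" using \<C>1(2) by blast
      moreover have "f x = f y" if "C \<in> \<C>1" "x \<in> C" "y \<in> C" for C x y
        using \<C>1(2) \<C>'(5) that by blast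
      ultimately show ?thesis using \<C>1 m'(1) \<C>'(3) unfolding equal_clusters_def by blast
    qed
    have "real (card (\<Union>\<C> - \<Union>\<C>1)) \<le> real (card \<C> * 4 ^ K * m')"
      using \<C>1(3) by (rule of_nat_mono)
    also have "\<dots> = real (card \<C>) * 4 ^ K * real m'" by simp
    also have "\<dots> \<le> real (card \<C>) * 4 ^ K * (c * real m)"
      using m' by (intro mult_left_mono) auto
    also have "\<dots> = \<tau> * (real (card \<C>) * real m)" by (simp add: c_def)
    also have "real (card \<C>) * real m = real (card (\<Union>\<C>))"
    proof -
      have "card (\<Union>\<C>) = (\<Sum>C\<in>\<C>. card C)"
        using \<C>'(2) finC by (intro card_Union_disjoint) auto
      then show ?thesis using \<C>'(4) by simp
    qed
    also have "\<tau> * real (card (\<Union>\<C>)) \<le> \<tau> * real (card V)"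
      using \<C>V V(1) assms by (intro mult_left_mono of_nat_mono card_mono) auto
    finally have "real (card (\<Union>\<C> - \<Union>\<C>1)) \<le> \<tau> * real (card V)" .
    moreover have "card (Y - \<Union>\<C>1) \<le> card (Y - \<Union>\<C>) + card (\<Union>\<C> - \<Union>\<C>1)"
    proof -
      have "card (Y - \<Union>\<C>1) \<le> card ((Y - \<Union>\<C>) \<union> (\<Union>\<C> - \<Union>\<C>1))"
        using finY \<C>'(3) by (intro card_mono) (auto intro: finite_subset)
      then show ?thesis using card_Un_le le_trans by blast
    qed
    ultimately have left: "real (card (Y - \<Union>\<C>1)) \<le> real (card (Y - \<Union>\<C>)) + \<tau> * real (card V)"
      by linarith
    have "c * \<nu> / 2 * real k = c * (\<nu> * real k) / 2" by simp
    also have "\<dots> \<le> c * real m / 2" using m c by (intro divide_right_mono mult_left_mono) auto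
    also have "\<dots> \<le> real m'" using m' by simp
    finally have low: "c * \<nu> / 2 * real k \<le> real m'" .
    have "real m' \<le> real m" using m'(3) c by (metis mult_left_le_one_le of_nat_0_le_iff order_less_imp_le order_trans)
    then have "m' \<le> m" by simp
    then show "\<exists>\<C>' m'. equal_clusters Y f m' \<C>' \<and> c * \<nu> / 2 * real k \<le> real m' \<and> m' \<le> m \<and>
       real (card (Y - \<Union>\<C>')) \<le> real (card (Y - \<Union>\<C>)) + \<tau> * real (card V) \<and>
       cluster_energy V E \<C> + \<epsilon> ^ 4 * \<eta> * real k * real (card V)
         \<le> cluster_energy V E \<C>'"
      using cl low left gain by blast
  qed
qed

text \<open>A regularity lemma that bounds the relative size of the clusters but not their number. The
  labelling \<open>f\<close> prescribes an initial partition with at most \<open>n/(tk)\<close> parts, which the clusters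
  respect. After \<open>j\<close> rounds that all failed the energy is at least \<open>j\<epsilon>\<^sup>4\<eta>kn\<close>, which is
  impossible once it exceeds \<open>\<omega>kn\<close>.\<close>

lemma bounded_degree_regularity:
  fixes \<epsilon> \<eta> d \<theta> \<mu> t \<omega> :: real
  assumes "\<epsilon> > 0" "\<eta> > 0" "d > 0" "\<theta> > 0" "\<mu> > 0" "t > 0"
  shows "\<exists>\<nu>>0. \<exists>k0::nat. \<forall>k\<ge>k0. \<forall>V E Y. \<forall>f :: 'a \<Rightarrow> 'b.
    bounded_relation (\<omega> * real k) V E \<longrightarrow> Y \<subseteq> V \<longrightarrow>
    real (card (f ` Y)) * (t * real k) \<le> real (card V) \<longrightarrow>
    (\<exists>\<C> m. equal_clusters Y f m \<C> \<and> \<nu> * real k \<le> real m \<and> real m \<le> \<mu> * real k \<and>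
       real (card (Y - \<Union>\<C>)) \<le> \<theta> * real (card V) \<and>
       irregular_mass \<epsilon> d E \<C> \<le> \<eta> * real k * real (card V))"
proof -
  define N where "N = nat \<lfloor>\<omega> / (\<epsilon> ^ 4 * \<eta>)\<rfloor> + 1"
  have e4: "\<epsilon> ^ 4 * \<eta> > 0" using assms by simp
  have "\<omega> / (\<epsilon> ^ 4 * \<eta>) < real N" unfolding N_def by linarith
  then have N: "\<omega> < real N * (\<epsilon> ^ 4 * \<eta>)" using e4 by (simp add: divide_less_eq)
  \<comment> \<open>The initial cutting and each of the \<open>N\<close> rounds may waste \<open>\<tau>n\<close> vertices.\<close>
  define \<tau> where "\<tau> = min \<theta> 1 / real (N + 1)"
  have \<tau>: "\<tau> > 0" "\<tau> \<le> 1" "\<tau> * real (N + 1) \<le> \<theta>"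
    using assms by (auto simp: \<tau>_def divide_le_eq)
  have iter: "\<exists>\<nu>>0. \<exists>k0::nat. \<forall>k\<ge>k0. \<forall>V E Y. \<forall>f :: 'a \<Rightarrow> 'b.
    bounded_relation (\<omega> * real k) V E \<longrightarrow> Y \<subseteq> V \<longrightarrow>
    real (card (f ` Y)) * (t * real k) \<le> real (card V) \<longrightarrow>
    (\<exists>\<C> m. equal_clusters Y f m \<C> \<and> \<nu> * real k \<le> real m \<and> real m \<le> \<mu> * real k \<and>
       real (card (Y - \<Union>\<C>)) \<le> \<tau> * real (j + 1) * real (card V) \<and>
       (irregular_mass \<epsilon> d E \<C> \<le> \<eta> * real k * real (card V) \<or>
        real j * (\<epsilon> ^ 4 * \<eta> * real k * real (card V)) \<le> cluster_energy V E \<C>))" for j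
  proof (induction j)
    case 0
    have nonneg: "0 \<le> cluster_energy V E \<C>" for V :: "'a set" and E \<C>
      by (simp add: cluster_energy_def energy_def sum_nonneg)
    obtain \<nu> and k0 :: nat where \<nu>: "\<nu> > 0" and init: "\<forall>k\<ge>k0. \<forall>V Y. \<forall>f :: 'a \<Rightarrow> 'b. finite V \<longrightarrow> Y \<subseteq> V \<longrightarrow>
      real (card (f ` Y)) * (t * real k) \<le> real (card V) \<longrightarrow>
      (\<exists>\<C> m. equal_clusters Y f m \<C> \<and> \<nu> * real k \<le> real m \<and> real m \<le> \<mu> * real k \<and>
       real (card (Y - \<Union>\<C>)) \<le> \<tau> * real (card V))"
      using initial_clusters[OF \<open>t > 0\<close> \<open>\<mu> > 0\<close> \<tau>(1), where ?'a = 'a and ?'b = 'b]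
      by (elim exE conjE) (rule that)
    show ?case
    proof (rule exI[of _ \<nu>], intro conjI exI[of _ k0] allI impI \<nu>)
      fix k :: nat and V Y :: "'a set" and E and f :: "'a \<Rightarrow> 'b"
      assume k: "k0 \<le> k" "bounded_relation (\<omega> * real k) V E" "Y \<subseteq> V"
        "real (card (f ` Y)) * (t * real k) \<le> real (card V)"
      have "finite V" using k(2) by (simp add: bounded_relation_def)
      from init[rule_format, OF k(1) this k(3,4)] nonneg
      show "\<exists>\<C> m. equal_clusters Y f m \<C> \<and> \<nu> * real k \<le> real m \<and> real m \<le> \<mu> * real k \<and>
       real (card (Y - \<Union>\<C>)) \<le> \<tau> * real (0 + 1) * real (card V) \<and>
       (irregular_mass \<epsilon> d E \<C> \<le> \<eta> * real k * real (card V) \<or>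
        real 0 * (\<epsilon> ^ 4 * \<eta> * real k * real (card V)) \<le> cluster_energy V E \<C>)"
        by simp
    qed
  next
    case (Suc j)
    then obtain \<nu> and k0 :: nat where \<nu>: "\<nu> > 0" and IH: "\<forall>k\<ge>k0. \<forall>V E Y. \<forall>f :: 'a \<Rightarrow> 'b. bounded_relation (\<omega> * real k) V E \<longrightarrow> Y \<subseteq> V \<longrightarrow>
      real (card (f ` Y)) * (t * real k) \<le> real (card V) \<longrightarrow>
      (\<exists>\<C> m. equal_clusters Y f m \<C> \<and> \<nu> * real k \<le> real m \<and> real m \<le> \<mu> * real k \<and>
       real (card (Y - \<Union>\<C>)) \<le> \<tau> * real (j + 1) * real (card V) \<and>
       (irregular_mass \<epsilon> d E \<C> \<le> \<eta> * real k * real (card V) \<or>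
        real j * (\<epsilon> ^ 4 * \<eta> * real k * real (card V)) \<le> cluster_energy V E \<C>))"
      by (elim exE conjE) (rule that)
    obtain \<nu>' and k1 :: nat where \<nu>': "\<nu>' > 0" and step: "\<forall>k\<ge>k1. \<forall>V E Y. \<forall>f :: 'a \<Rightarrow> 'b. \<forall>\<C> m. bounded_relation (\<omega> * real k) V E \<longrightarrow> Y \<subseteq> V \<longrightarrow>
      equal_clusters Y f m \<C> \<longrightarrow> \<nu> * real k \<le> real m \<longrightarrow>
      \<eta> * real k * real (card V) < irregular_mass \<epsilon> d E \<C> \<longrightarrow>
      (\<exists>\<C>' m'. equal_clusters Y f m' \<C>' \<and> \<nu>' * real k \<le> real m' \<and> m' \<le> m \<and>
       real (card (Y - \<Union>\<C>')) \<le> real (card (Y - \<Union>\<C>)) + \<tau> * real (card V) \<and>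
       cluster_energy V E \<C> + \<epsilon> ^ 4 * \<eta> * real k * real (card V) \<le> cluster_energy V E \<C>')"
      using refine_clusters[OF assms(1-3) \<nu> \<tau>(1,2), where ?'a = 'a and ?'b = 'b and \<omega> = \<omega>]
      by (elim exE conjE) (rule that)
    show ?case
    proof (rule exI[of _ "min \<nu> \<nu>'"], intro conjI exI[of _ "max k0 k1"] allI impI)
      show "min \<nu> \<nu>' > 0" using \<nu> \<nu>' by simp
      fix k :: nat and V Y :: "'a set" and E and f :: "'a \<Rightarrow> 'b"
      assume k: "max k0 k1 \<le> k" and V: "bounded_relation (\<omega> * real k) V E" "Y \<subseteq> V"
        "real (card (f ` Y)) * (t * real k) \<le> real (card V)"
      have k': "k0 \<le> k" "k1 \<le> k" using k by auto
      obtain \<C> m where \<C>: "equal_clusters Y f m \<C>" "\<nu> * real k \<le> real m" "real m \<le> \<mu> * real k"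
        "real (card (Y - \<Union>\<C>)) \<le> \<tau> * real (j + 1) * real (card V)"
        "irregular_mass \<epsilon> d E \<C> \<le> \<eta> * real k * real (card V) \<or>
         real j * (\<epsilon> ^ 4 * \<eta> * real k * real (card V)) \<le> cluster_energy V E \<C>"
        using IH[rule_format, OF k'(1) V] by blast
      have min: "min \<nu> \<nu>' * real k \<le> \<nu> * real k" "min \<nu> \<nu>' * real k \<le> \<nu>' * real k"
        by (intro mult_right_mono; simp)+
      have more: "\<tau> * real (j + 1) * real (card V) + \<tau> * real (card V) = \<tau> * real (Suc j + 1) * real (card V)"
        by (simp add: algebra_simps)
      have "0 \<le> \<tau> * real (card V)" using \<tau> by simp
      show "\<exists>\<C> m. equal_clusters Y f m \<C> \<and> min \<nu> \<nu>' * real k \<le> real m \<and> real m \<le> \<mu> * real k \<and>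
       real (card (Y - \<Union>\<C>)) \<le> \<tau> * real (Suc j + 1) * real (card V) \<and>
       (irregular_mass \<epsilon> d E \<C> \<le> \<eta> * real k * real (card V) \<or>
        real (Suc j) * (\<epsilon> ^ 4 * \<eta> * real k * real (card V)) \<le> cluster_energy V E \<C>)"
      proof (cases "irregular_mass \<epsilon> d E \<C> \<le> \<eta> * real k * real (card V)")
        case True
        moreover have "min \<nu> \<nu>' * real k \<le> real m" using min \<C>(2) by linarith
        moreover have "real (card (Y - \<Union>\<C>)) \<le> \<tau> * real (Suc j + 1) * real (card V)"
          using \<C>(4) more \<open>0 \<le> \<tau> * real (card V)\<close> by linarith
        ultimately show ?thesis using \<C>(1,3) by blast
      next
        case False
        then obtain \<C>' m' where \<C>': "equal_clusters Y f m' \<C>'" "\<nu>' * real k \<le> real m'" "m' \<le> m"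
          "real (card (Y - \<Union>\<C>')) \<le> real (card (Y - \<Union>\<C>)) + \<tau> * real (card V)"
          "cluster_energy V E \<C> + \<epsilon> ^ 4 * \<eta> * real k * real (card V) \<le> cluster_energy V E \<C>'"
          using step[rule_format, OF k'(2) V(1,2) \<C>(1,2)] by (auto simp: not_le)
        have "real (Suc j) * (\<epsilon> ^ 4 * \<eta> * real k * real (card V)) \<le> cluster_energy V E \<C>'"
          using \<C>(5) False \<C>'(5) by (simp add: algebra_simps)
        moreover have "min \<nu> \<nu>' * real k \<le> real m'" using min \<C>'(2) by linarith
        moreover have "real m' \<le> \<mu> * real k" using \<C>'(3) \<C>(3) by linarith
        moreover have "real (card (Y - \<Union>\<C>')) \<le> \<tau> * real (Suc j + 1) * real (card V)"
          using \<C>'(4) \<C>(4) more by linarith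
        ultimately show ?thesis using \<C>'(1) by blast
      qed
    qed
  qed
  obtain \<nu> and k0 :: nat where \<nu>: "\<nu> > 0" and fin: "\<forall>k\<ge>k0. \<forall>V E Y. \<forall>f :: 'a \<Rightarrow> 'b. bounded_relation (\<omega> * real k) V E \<longrightarrow> Y \<subseteq> V \<longrightarrow>
      real (card (f ` Y)) * (t * real k) \<le> real (card V) \<longrightarrow>
      (\<exists>\<C> m. equal_clusters Y f m \<C> \<and> \<nu> * real k \<le> real m \<and> real m \<le> \<mu> * real k \<and>
       real (card (Y - \<Union>\<C>)) \<le> \<tau> * real (N + 1) * real (card V) \<and>
       (irregular_mass \<epsilon> d E \<C> \<le> \<eta> * real k * real (card V) \<or>
        real N * (\<epsilon> ^ 4 * \<eta> * real k * real (card V)) \<le> cluster_energy V E \<C>))"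
    using iter[of N] by (elim exE conjE) (rule that)
  show ?thesis
  proof (rule exI[of _ \<nu>], intro conjI exI[of _ k0] allI impI \<nu>)
    fix k :: nat and V Y :: "'a set" and E and f :: "'a \<Rightarrow> 'b"
    assume k: "k0 \<le> k" and V: "bounded_relation (\<omega> * real k) V E" "Y \<subseteq> V"
      "real (card (f ` Y)) * (t * real k) \<le> real (card V)"
    obtain \<C> m where \<C>: "equal_clusters Y f m \<C>" "\<nu> * real k \<le> real m" "real m \<le> \<mu> * real k"
      "real (card (Y - \<Union>\<C>)) \<le> \<tau> * real (N + 1) * real (card V)"
      "irregular_mass \<epsilon> d E \<C> \<le> \<eta> * real k * real (card V) \<or>
       real N * (\<epsilon> ^ 4 * \<eta> * real k * real (card V)) \<le> cluster_energy V E \<C>"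
      using fin[rule_format, OF k V] by blast
    have E: "finite V" "E \<subseteq> V \<times> V" "sym E" "\<And>x. real (card (E `` {x})) \<le> \<omega> * real k"
      using V(1) by (auto simp: bounded_relation_def)
    have "irregular_mass \<epsilon> d E \<C> \<le> \<eta> * real k * real (card V)"
    proof (cases "k = 0 \<or> V = {}")
      case True
      have "E = {}"
      proof (cases "k = 0")
        case True
        have "E `` {x} = {}" for x
          using E(4)[of x] True finite_subset[OF E(2)] E(1) by (simp add: finite_Image)
        then have "(x, y) \<notin> E" for x y by (metis Image_singleton_iff empty_iff)
        then show ?thesis by auto
      qed (use True E(2) in auto)
      then show ?thesis using assms by (simp add: irregular_mass_def)
    next
      case False
      have "cluster_energy V E \<C> \<le> real (card V) * (\<omega> * real k)"
        unfolding cluster_energy_def by (rule energy_le_degree[OF E(1,2,4) \<C>(1) V(2)])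
      also have "\<dots> < real N * (\<epsilon> ^ 4 * \<eta> * real k * real (card V))"
      proof -
        have "\<omega> * (real k * real (card V)) < real N * (\<epsilon> ^ 4 * \<eta>) * (real k * real (card V))"
          using N False E(1) by (intro mult_strict_right_mono) (auto simp: card_gt_0_iff)
        then show ?thesis by (simp add: mult_ac)
      qed
      finally show ?thesis using \<C>(5) by simp
    qed
    moreover have "real (card (Y - \<Union>\<C>)) \<le> \<theta> * real (card V)"
      using \<C>(4) mult_right_mono[OF \<tau>(3), of "real (card V)"] by simp
    ultimately show "\<exists>\<C> m. equal_clusters Y f m \<C> \<and> \<nu> * real k \<le> real m \<and> real m \<le> \<mu> * real k \<and>
       real (card (Y - \<Union>\<C>)) \<le> \<theta> * real (card V) \<and> irregular_mass \<epsilon> d E \<C> \<le> \<eta> * real k * real (card V)"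
      using \<C>(1-3) by blast
  qed
qed

section \<open>Packings of dense spots\<close>

lemma min_degree_greater_iff:
  assumes "finite (verts H)"
  shows "min_degree H > ereal r \<longleftrightarrow> (\<forall>v\<in>verts H. real (degree H v) > r)"
proof -
  have "ereal r < (INF v\<in>S. ereal (f v)) \<longleftrightarrow> (\<forall>v\<in>S. f v > r)" if "finite S" for S and f :: "'a \<Rightarrow> real"
    using that by (induction S) (auto simp: inf_min top_ereal_def)
  then show ?thesis using assms by (simp add: min_degree_def)
qed

lemma finite_edges: "simple_graph G \<Longrightarrow> finite (edges G)"
  by (rule finite_subset[of _ "Pow (verts G)"]) (auto simp: simple_graph_def)

lemma edge_ends: "simple_graph G \<Longrightarrow> {x, y} \<in> edges G \<Longrightarrow> x \<in> verts G \<and> y \<in> verts G"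
  by (fastforce simp: simple_graph_def)

lemma card_edges_at:
  assumes "simple_graph G" "v \<in> verts G"
  shows "card {e \<in> edges G. v \<in> e} = degree G v"
proof -
  have "bij_betw (\<lambda>u. {v, u}) {u \<in> verts G. {v, u} \<in> edges G} {e \<in> edges G. v \<in> e}"
  proof (rule bij_betw_imageI)
    show "inj_on (\<lambda>u. {v, u}) {u \<in> verts G. {v, u} \<in> edges G}"
      by (auto simp: inj_on_def doubleton_eq_iff)
    show "(\<lambda>u. {v, u}) ` {u \<in> verts G. {v, u} \<in> edges G} = {e \<in> edges G. v \<in> e}"
    proof (intro set_eqI iffI)
      fix e assume e: "e \<in> {e \<in> edges G. v \<in> e}"
      then have "card e = 2" using assms by (auto simp: simple_graph_def)
      then obtain a b where ab: "e = {a, b}" by (auto simp: card_2_iff)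
      then have "e = {v, if v = a then b else a}" using e by auto
      then show "e \<in> (\<lambda>u. {v, u}) ` {u \<in> verts G. {v, u} \<in> edges G}"
        using e edge_ends[OF assms(1), of a b] ab by (intro image_eqI) auto
    qed auto
  qed
  then show ?thesis by (simp add: bij_betw_same_card degree_def deg_in_def)
qed

text \<open>The two classes form an unordered pair, so an equation between spots fixes them only up to order.
  Every condition is symmetric in the classes and may therefore be read off in either order.\<close>

lemma dense_spot_iff:
  assumes G: "simple_graph G"
  shows "dense_spot m \<gamma> G (Spot (Upair U W) F) \<longleftrightarrow>
    U \<inter> W = {} \<and> U \<union> W \<subseteq> verts G \<and> F \<subseteq> edges G \<and> F \<noteq> {} \<and>
    (\<forall>e\<in>F. \<exists>u\<in>U. \<exists>w\<in>W. e = {u, w}) \<and>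
    \<gamma> * (real (card U) * real (card W)) < real (card F) \<and>
    (\<forall>v\<in>U \<union> W. m < real (card {u \<in> U \<union> W. {v, u} \<in> F}))" (is "?L \<longleftrightarrow> ?R")
proof -
  let ?D = "Spot (Upair U W) F"
  have 1: "?L \<longleftrightarrow> U \<inter> W = {} \<and> (\<forall>e\<in>F. \<exists>u\<in>U. \<exists>w\<in>W. e = {u, w}) \<and> F \<noteq> {} \<and>
     subgraph (spot_graph ?D) G \<and>
     real (card F) / (real (card U) * real (card W)) > \<gamma> \<and>
     min_degree (spot_graph ?D) > ereal m"
  proof -
    have "(\<forall>e\<in>F. \<exists>u\<in>U. \<exists>w\<in>W. e = {u, w}) \<longleftrightarrow> (\<forall>e\<in>F. \<exists>u\<in>W. \<exists>w\<in>U. e = {u, w})"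
      by (metis insert_commute)
    then show ?thesis unfolding dense_spot_def by (auto simp: mult.commute Int_commute)
  qed
  show ?thesis
  proof (cases "U \<inter> W = {} \<and> U \<union> W \<subseteq> verts G \<and> F \<subseteq> edges G \<and> F \<noteq> {} \<and>
      (\<forall>e\<in>F. \<exists>u\<in>U. \<exists>w\<in>W. e = {u, w})")
    case True
    then have fin: "finite U" "finite W"
      using G by (auto simp: simple_graph_def intro: finite_subset)
    from True obtain e u w where "e \<in> F" "u \<in> U" "w \<in> W" by (metis all_not_in_conv)
    then have "card U > 0" "card W > 0" using fin by (auto simp: card_gt_0_iff)
    then have pos: "real (card U) * real (card W) > 0" by simp
    have e1: "subgraph (spot_graph ?D) G"
      using True fin G by (auto simp: subgraph_def spot_graph_def spot_verts_def simple_graph_def)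
    have e2: "min_degree (spot_graph ?D) > ereal m \<longleftrightarrow>
       (\<forall>v\<in>U \<union> W. m < real (card {u \<in> U \<union> W. {v, u} \<in> F}))"
      using fin by (subst min_degree_greater_iff)
        (auto simp: spot_graph_def spot_verts_def degree_def deg_in_def)
    have e3: "real (card F) / (real (card U) * real (card W)) > \<gamma> \<longleftrightarrow>
       \<gamma> * (real (card U) * real (card W)) < real (card F)"
      using pos by (rule pos_less_divide_eq)
    show ?thesis unfolding 1 e2 e3 using True e1 by argo
  next
    case False
    have "U \<union> W \<subseteq> verts G \<and> F \<subseteq> edges G" if "subgraph (spot_graph ?D) G"
      using that by (auto simp: subgraph_def spot_graph_def spot_verts_def)
    then show ?thesis unfolding 1 using False by argo
  qed
qed

lemma dense_spot_edges: "dense_spot m \<gamma> G D \<Longrightarrow> spot_edges D \<subseteq> edges G \<and> spot_edges D \<noteq> {}"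
  by (auto simp: dense_spot_def subgraph_def spot_graph_def)

lemma spot_cases: obtains U W F where "D = Spot (Upair U W) F"
  by (metis spot.exhaust uprod_exhaust)

definition spot_packing :: "real \<Rightarrow> real \<Rightarrow> 'a graph \<Rightarrow> 'a spot set \<Rightarrow> bool" where
  "spot_packing m \<gamma> G \<D> \<longleftrightarrow>
     (\<forall>D\<in>\<D>. dense_spot m \<gamma> G D) \<and> disjoint_family_on spot_edges \<D>"

text \<open>Maximal in the number of covered edges rather than under inclusion: enlarging a single spot has to
  count as progress.\<close>

definition maximal_spot_packing :: "real \<Rightarrow> real \<Rightarrow> 'a graph \<Rightarrow> 'a spot set \<Rightarrow> bool" where
  "maximal_spot_packing m \<gamma> G \<D> \<longleftrightarrow> spot_packing m \<gamma> G \<D> \<and>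
     (\<forall>\<D>'. spot_packing m \<gamma> G \<D>' \<longrightarrow> card (family_edges \<D>') \<le> card (family_edges \<D>))"

lemma spot_packing_edges:
  assumes "spot_packing m \<gamma> G \<D>"
  shows "family_edges \<D> \<subseteq> edges G"
  using assms dense_spot_edges unfolding spot_packing_def family_edges_def by blast

lemma ex_maximal_spot_packing:
  assumes "simple_graph G"
  shows "\<exists>\<D>. maximal_spot_packing m \<gamma> G \<D>"
proof -
  have "spot_packing m \<gamma> G {}" by (simp add: spot_packing_def disjoint_family_on_def)
  moreover have "card (family_edges \<D>) < Suc (card (edges G))" if "spot_packing m \<gamma> G \<D>" for \<D>
    using card_mono[OF finite_edges[OF assms] spot_packing_edges[OF that]] by simp
  ultimately show ?thesis
    using ex_has_greatest_nat[of "spot_packing m \<gamma> G" "{}" "\<lambda>\<D>. card (family_edges \<D>)"]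
    unfolding maximal_spot_packing_def by (meson less_imp_le_nat)
qed

lemma finite_spot_packing:
  assumes G: "simple_graph G" and \<D>: "spot_packing m \<gamma> G \<D>"
  shows "finite \<D>"
proof (rule inj_on_finite[of spot_edges])
  have ne: "spot_edges D \<noteq> {}" if "D \<in> \<D>" for D
    using that \<D> dense_spot_edges unfolding spot_packing_def by blast
  then show "inj_on spot_edges \<D>"
    using \<D> unfolding inj_on_def spot_packing_def disjoint_family_on_def by (metis inf.idem)
  show "spot_edges ` \<D> \<subseteq> Pow (edges G)"
    using spot_packing_edges[OF \<D>] by (auto simp: family_edges_def)
  show "finite (Pow (edges G))" using finite_edges[OF G] by simp
qed

lemma maximal_spot_packing_no_more:
  assumes G: "simple_graph G" and \<D>: "maximal_spot_packing m \<gamma> G \<D>" and D: "dense_spot m \<gamma> G D"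
  shows "spot_edges D \<inter> family_edges \<D> \<noteq> {}"
proof
  assume dis: "spot_edges D \<inter> family_edges \<D> = {}"
  have pack: "spot_packing m \<gamma> G \<D>" using \<D> by (simp add: maximal_spot_packing_def)
  have "spot_packing m \<gamma> G (insert D \<D>)"
    using pack D dis by (auto simp: spot_packing_def disjoint_family_on_def family_edges_def)
  then have "card (family_edges (insert D \<D>)) \<le> card (family_edges \<D>)"
    using \<D> by (auto simp: maximal_spot_packing_def)
  moreover have "family_edges (insert D \<D>) = spot_edges D \<union> family_edges \<D>"
    by (simp add: family_edges_def)
  then have "family_edges \<D> \<subset> family_edges (insert D \<D>)"
    using dense_spot_edges[OF D] dis by blast
  moreover have "finite (family_edges (insert D \<D>))"
    using spot_packing_edges[OF \<open>spot_packing m \<gamma> G (insert D \<D>)\<close>] finite_edges[OF G] finite_subset by blast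
  ultimately show False using psubset_card_mono by (metis not_less)
qed

text \<open>Adding a missing edge between the classes to the edge set of the spot keeps it a dense spot and
  keeps the family edge-disjoint, but covers one edge more.\<close>

lemma maximal_spot_packing_covers:
  assumes G: "simple_graph G" and \<D>: "maximal_spot_packing m \<gamma> G \<D>"
    and D: "Spot (Upair U W) F \<in> \<D>"
  shows "edges_between G U W \<subseteq> family_edges \<D>"
proof (rule ccontr)
  assume "\<not> ?thesis"
  then obtain u w where uw: "u \<in> U" "w \<in> W" "{u, w} \<in> edges G" "{u, w} \<notin> family_edges \<D>"
    by (auto simp: edges_between_def)
  define e where "e = {u, w}"
  let ?D = "Spot (Upair U W) F" and ?D' = "Spot (Upair U W) (insert e F)"
  have pack: "spot_packing m \<gamma> G \<D>" using \<D> by (simp add: maximal_spot_packing_def)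
  then have "dense_spot m \<gamma> G ?D" using D by (simp add: spot_packing_def)
  note spot = this[unfolded dense_spot_iff[OF G]]
  have R: "U \<inter> W = {}" "U \<union> W \<subseteq> verts G" "F \<subseteq> edges G" "\<forall>e\<in>F. \<exists>u\<in>U. \<exists>w\<in>W. e = {u, w}"
     "\<gamma> * (real (card U) * real (card W)) < real (card F)"
     "\<And>v. v \<in> U \<union> W \<Longrightarrow> m < real (card {u \<in> U \<union> W. {v, u} \<in> F})"
    using spot by simp_all
  have finF: "finite F" using R(3) finite_edges[OF G] finite_subset by blast
  have finUW: "finite (U \<union> W)" using R(2) G finite_subset by (auto simp: simple_graph_def)
  have "dense_spot m \<gamma> G ?D'"
    unfolding dense_spot_iff[OF G]
  proof (intro conjI ballI)
    have "card F \<le> card (insert e F)" using finF by (intro card_mono) auto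
    then show "\<gamma> * (real (card U) * real (card W)) < real (card (insert e F))"
      using R(5) by linarith
  next
    fix v assume v: "v \<in> U \<union> W"
    have "card {u \<in> U \<union> W. {v, u} \<in> F} \<le> card {u \<in> U \<union> W. {v, u} \<in> insert e F}"
      using finUW by (intro card_mono) auto
    then show "m < real (card {u \<in> U \<union> W. {v, u} \<in> insert e F})" using R(6)[OF v] by linarith
  next
    fix x assume "x \<in> insert e F"
    then show "\<exists>u\<in>U. \<exists>w\<in>W. x = {u, w}" using R(4) uw(1,2) e_def by blast
  qed (use R uw e_def in auto)
  moreover have "spot_edges E \<inter> insert e F = {}" if "E \<in> \<D> - {?D}" for E
  proof -
    have "spot_edges E \<inter> F = {}"
      using that D pack by (force simp: spot_packing_def disjoint_family_on_def)
    moreover have "e \<notin> spot_edges E" using uw(4) that by (auto simp: e_def family_edges_def)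
    ultimately show ?thesis by blast
  qed
  moreover have "disjoint_family_on spot_edges (\<D> - {?D})"
    using pack by (auto simp: spot_packing_def intro: disjoint_family_on_mono[rotated])
  ultimately have pack': "spot_packing m \<gamma> G (insert ?D' (\<D> - {?D}))"
    using pack by (auto simp: spot_packing_def disjoint_family_on_def)
  then have "card (family_edges (insert ?D' (\<D> - {?D}))) \<le> card (family_edges \<D>)"
    using \<D> by (auto simp: maximal_spot_packing_def)
  moreover have "family_edges (insert ?D' (\<D> - {?D})) = insert e (family_edges \<D>)"
    using D by (auto simp: family_edges_def)
  moreover have "finite (family_edges \<D>)"
    using spot_packing_edges[OF pack] finite_edges[OF G] finite_subset by blast
  ultimately show False using uw(4) by (simp add: e_def)
qed

text \<open>The spots at \<open>v\<close> use disjoint sets of edges at \<open>v\<close>, each larger than \<open>m\<close>.\<close>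

lemma card_spots_at_vertex:
  assumes G: "simple_graph G" and \<D>: "spot_packing m \<gamma> G \<D>" and v: "v \<in> verts G"
  shows "real (card {D \<in> \<D>. v \<in> spot_verts D}) * m \<le> real (degree G v)"
proof -
  let ?N = "{D \<in> \<D>. v \<in> spot_verts D}"
  let ?S = "\<lambda>D. {u \<in> verts G. {v, u} \<in> spot_edges D}"
  have finV: "finite (verts G)" using G by (simp add: simple_graph_def)
  have finN: "finite ?N" using finite_spot_packing[OF G \<D>] by simp
  have "real (card ?N) * m = (\<Sum>D\<in>?N. m)" by simp
  also have "\<dots> \<le> (\<Sum>D\<in>?N. real (card (?S D)))"
  proof (rule sum_mono)
    fix D assume D: "D \<in> ?N"
    obtain U W F where UWF: "D = Spot (Upair U W) F" by (rule spot_cases)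
    have "dense_spot m \<gamma> G (Spot (Upair U W) F)" using D \<D> UWF by (auto simp: spot_packing_def)
    moreover have "v \<in> U \<union> W" using D by (auto simp: UWF spot_verts_def)
    ultimately have "m < real (card {u \<in> U \<union> W. {v, u} \<in> F})" "U \<union> W \<subseteq> verts G"
      unfolding dense_spot_iff[OF G] by auto
    moreover have "card {u \<in> U \<union> W. {v, u} \<in> F} \<le> card (?S D)"
      using finV \<open>U \<union> W \<subseteq> verts G\<close> by (intro card_mono) (auto simp: UWF)
    ultimately show "m \<le> real (card (?S D))" by linarith
  qed
  also have "\<dots> = real (card (\<Union>D\<in>?N. ?S D))"
  proof -
    have "card (\<Union>D\<in>?N. ?S D) = (\<Sum>D\<in>?N. card (?S D))"
    proof (rule card_UN_disjoint[OF finN])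
      show "\<forall>D\<in>?N. \<forall>D'\<in>?N. D \<noteq> D' \<longrightarrow> ?S D \<inter> ?S D' = {}"
        using \<D> unfolding spot_packing_def disjoint_family_on_def by blast
    qed (use finV in auto)
    then show ?thesis by simp
  qed
  also have "\<dots> \<le> real (degree G v)"
    unfolding degree_def deg_in_def
    using finV spot_packing_edges[OF \<D>] by (intro of_nat_mono card_mono) (auto simp: family_edges_def)
  finally show ?thesis .
qed

text \<open>Delete vertices of degree at most \<open>r\<close> one by one; each costs at most \<open>r\<close> edges. The process may
  end with the null graph, whose minimum degree is infinite.\<close>

lemma ex_large_min_degree_subgraph:
  assumes "simple_graph G" "r \<ge> 0"
  shows "\<exists>H. subgraph H G \<and> min_degree H > ereal r \<and>
    real (card (edges G - edges H)) \<le> r * real (card (verts G))"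
  using assms(1)
proof (induction "card (verts G)" arbitrary: G rule: less_induct)
  case less
  have finV: "finite (verts G)" using less.prems by (simp add: simple_graph_def)
  show ?case
  proof (cases "min_degree G > ereal r")
    case True
    then show ?thesis using less.prems \<open>r \<ge> 0\<close> by (intro exI[of _ G]) (simp add: subgraph_def)
  next
    case False
    then obtain v where v: "v \<in> verts G" "real (degree G v) \<le> r"
      using min_degree_greater_iff[OF finV] by (auto simp: not_less)
    define G' where "G' = \<lparr>verts = verts G - {v}, edges = {e \<in> edges G. v \<notin> e}\<rparr>"
    have "card (verts G) = Suc (card (verts G'))"
      using v(1) finV card_Suc_Diff1[of "verts G" v] by (simp add: G'_def)
    then have G': "simple_graph G'" "card (verts G') < card (verts G)" "card (verts G) = Suc (card (verts G'))"
      using less.prems by (auto simp: G'_def simple_graph_def)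
    from less.hyps[OF G'(2,1)] obtain H where H: "subgraph H G'" "min_degree H > ereal r"
      "real (card (edges G' - edges H)) \<le> r * real (card (verts G'))" by blast
    have "edges G - edges H \<subseteq> (edges G' - edges H) \<union> {e \<in> edges G. v \<in> e}"
      by (auto simp: G'_def)
    then have "card (edges G - edges H) \<le> card ((edges G' - edges H) \<union> {e \<in> edges G. v \<in> e})"
      using finite_edges[OF less.prems] finite_edges[OF G'(1)] by (intro card_mono) auto
    also have "\<dots> \<le> card (edges G' - edges H) + degree G v"
      using card_Un_le card_edges_at[OF less.prems v(1)] by metis
    finally have "real (card (edges G - edges H)) \<le> r * real (card (verts G')) + r"
      using H(3) v(2) by linarith
    also have "\<dots> = r * real (card (verts G))" using G'(3) by (simp add: algebra_simps)
    finally have "real (card (edges G - edges H)) \<le> r * real (card (verts G))" .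
    moreover have "subgraph H G" using H(1) by (auto simp: subgraph_def G'_def)
    ultimately show ?thesis using H(2) by blast
  qed
qed

lemma subgraph_dense_spot:
  assumes "dense_spot m \<gamma> H D" "subgraph H G"
  shows "dense_spot m \<gamma> G D"
proof -
  have "subgraph (spot_graph D) G" if "subgraph (spot_graph D) H"
    using that assms(2) by (auto simp: subgraph_def)
  then show ?thesis using assms(1) unfolding dense_spot_def by blast
qed

section \<open>The avoiding set\<close>

text \<open>Recording classes rather than spots also remembers on which side of each spot the vertex lies, so
  that a set with a constant signature is contained in or disjoint from each class.\<close>

definition spot_signature :: "'a spot set \<Rightarrow> 'a \<Rightarrow> 'a set set" where
  "spot_signature \<D> v = {X. v \<in> X \<and> (\<exists>D\<in>\<D>. X \<in> set_uprod (spot_classes D))}"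

definition rare :: "('a \<Rightarrow> 'b) \<Rightarrow> 'a set \<Rightarrow> real \<Rightarrow> 'a set" where
  "rare L X c = {v \<in> X. real (card {w \<in> X. L w = L v}) < c}"

lemma nat_le_sum_imp_real_le: "n \<le> (\<Sum>x\<in>S. f x) \<Longrightarrow> real n \<le> (\<Sum>x\<in>S. real (f x))"
  by (metis of_nat_mono of_nat_sum)

text \<open>Double counting of the pairs of a vertex of \<open>U\<close> and a spot containing it.\<close>

lemma card_bad_spots:
  assumes "finite \<D>" "finite U"
    and q: "\<And>u. u \<in> U \<Longrightarrow> real (card {D \<in> \<D>. u \<in> spot_verts D}) \<le> q"
  shows "real (card {D \<in> \<D>. c < real (card (U \<inter> spot_verts D))}) * c \<le> real (card U) * q"
proof -
  let ?N = "{D \<in> \<D>. c < real (card (U \<inter> spot_verts D))}"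
  have "real (card ?N) * c = (\<Sum>D\<in>?N. c)" by simp
  also have "\<dots> \<le> (\<Sum>D\<in>?N. real (card {u \<in> U. u \<in> spot_verts D}))"
    by (rule sum_mono) (auto simp: Int_def)
  also have "\<dots> = real (\<Sum>D\<in>?N. card {u \<in> U. u \<in> spot_verts D})" by simp
  also have "(\<Sum>D\<in>?N. card {u \<in> U. u \<in> spot_verts D}) = (\<Sum>u\<in>U. card {D \<in> ?N. u \<in> spot_verts D})"
    using assms by (intro sum_multicount_gen) auto
  also have "real \<dots> = (\<Sum>u\<in>U. real (card {D \<in> ?N. u \<in> spot_verts D}))" by simp
  also have "\<dots> \<le> (\<Sum>u\<in>U. q)"
  proof (rule sum_mono)
    fix u assume "u \<in> U"
    have "card {D \<in> ?N. u \<in> spot_verts D} \<le> card {D \<in> \<D>. u \<in> spot_verts D}"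
      using assms(1) by (intro card_mono) auto
    then show "real (card {D \<in> ?N. u \<in> spot_verts D}) \<le> q" using q[OF \<open>u \<in> U\<close>] by linarith
  qed
  finally show ?thesis by simp
qed

text \<open>A set \<open>U\<close> of at most \<open>\<Lambda>k\<close> vertices meets at most \<open>B\<close> spots in more than \<open>\<gamma>\<^sup>2k\<close>
  vertices. A vertex
  violating the avoiding condition lies in no other spot, so its signature is a subset of their
  at most \<open>2B\<close> classes. This leaves at most \<open>4\<^sup>Bp\<close> labels, each shared by fewer than \<open>tk\<close> vertices.\<close>

lemma avoiding_rare:
  assumes G: "simple_graph G" and \<D>: "finite \<D>"
    and X: "X = (\<Union>D\<in>\<D>. spot_verts D)" "X \<subseteq> verts G"
    and k: "k > 0" and \<gamma>: "\<gamma> > 0" and q: "q \<ge> 0"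
      "\<And>v. v \<in> verts G \<Longrightarrow> real (card {D \<in> \<D>. v \<in> spot_verts D}) \<le> q"
    and B: "q * \<Lambda> \<le> \<gamma>\<^sup>2 * real B"
    and g: "card (g ` verts G) \<le> p" and t: "t > 0" "4 ^ B * real p * t \<le> \<epsilon>"
  shows "avoiding \<Lambda> \<epsilon> \<gamma> k G \<D> (rare (\<lambda>v. (spot_signature \<D> v, g v)) X (t * real k))"
proof -
  define L where "L v = (spot_signature \<D> v, g v)" for v
  have finV: "finite (verts G)" using G by (simp add: simple_graph_def)
  have finX: "finite X" using X(2) finV finite_subset by blast
  show ?thesis
    unfolding avoiding_def L_def[symmetric]
  proof (intro conjI allI impI)
    show "rare L X (t * real k) \<subseteq> (\<Union>D\<in>\<D>. spot_verts D)" by (auto simp: rare_def X(1))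
  next
    fix U assume U: "U \<subseteq> verts G" "real (card U) \<le> \<Lambda> * real k"
    define c where "c = \<gamma>\<^sup>2 * real k"
    define N where "N = {D \<in> \<D>. c < real (card (U \<inter> spot_verts D))}"
    have c: "c > 0" using \<gamma> k by (simp add: c_def)
    have finU: "finite U" using U(1) finV finite_subset by blast
    have finN: "finite N" using \<D> by (simp add: N_def)
    have "real (card N) * c \<le> real (card U) * q"
      unfolding N_def using q(2) U(1) by (intro card_bad_spots[OF \<D> finU]) auto
    also have "\<dots> \<le> \<Lambda> * real k * q" using U(2) q(1) by (rule mult_right_mono)
    also have "\<dots> = (q * \<Lambda>) * real k" by simp
    also have "\<dots> \<le> \<gamma>\<^sup>2 * real B * real k" using B by (intro mult_right_mono) auto
    also have "\<dots> = real B * c" by (simp add: c_def)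
    finally have cardN: "card N \<le> B" using c by simp
    define Exc where "Exc = {v \<in> rare L X (t * real k). \<not> (\<exists>D\<in>\<D>. v \<in> spot_verts D \<and>
                                 real (card (U \<inter> spot_verts D)) \<le> c)}"
    define S where "S = Pow (\<Union>D\<in>N. set_uprod (spot_classes D))"
    have finS: "finite S" using finN by (simp add: S_def)
    have "card (\<Union>D\<in>N. set_uprod (spot_classes D)) \<le> (\<Sum>D\<in>N. card (set_uprod (spot_classes D)))"
      by (rule card_UN_le[OF finN])
    also have "\<dots> \<le> (\<Sum>D\<in>N. 2)"
    proof (rule sum_mono)
      fix D :: "'a spot"
      show "card (set_uprod (spot_classes D)) \<le> 2"
        by (cases "spot_classes D" rule: uprod_exhaust) (auto simp: card_insert_if)
    qed
    also have "\<dots> \<le> 2 * B" using cardN by simp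
    finally have "card S \<le> 2 ^ (2 * B)"
      using finN by (simp add: S_def card_Pow power_increasing)
    then have cardS: "card S \<le> 4 ^ B" by (simp add: power_mult)
    have lab: "L v \<in> S \<times> g ` verts G" if v: "v \<in> Exc" for v
    proof -
      have "D \<in> N" if D: "D \<in> \<D>" "v \<in> spot_verts D" for D
        using D v by (force simp: Exc_def N_def)
      then have "spot_signature \<D> v \<subseteq> (\<Union>D\<in>N. set_uprod (spot_classes D))"
        by (auto simp: spot_signature_def spot_verts_def)
      moreover have "v \<in> verts G" using v X(2) by (auto simp: Exc_def rare_def)
      ultimately show ?thesis by (simp add: L_def S_def)
    qed
    have "card (L ` Exc) \<le> card (S \<times> g ` verts G)"
    proof (rule card_mono)
      show "finite (S \<times> g ` verts G)" using finS finV by simp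
      show "L ` Exc \<subseteq> S \<times> g ` verts G" using lab by blast
    qed
    also have "\<dots> \<le> 4 ^ B * p"
      unfolding card_cartesian_product using cardS g by (rule mult_le_mono)
    finally have cardL: "card (L ` Exc) \<le> 4 ^ B * p" .
    have finE: "finite Exc" using finX by (auto simp: Exc_def rare_def)
    have "Exc \<subseteq> (\<Union>l\<in>L ` Exc. {w \<in> X. L w = l})" by (auto simp: Exc_def rare_def)
    then have "card Exc \<le> card (\<Union>l\<in>L ` Exc. {w \<in> X. L w = l})"
      using finE finX by (intro card_mono) auto
    also have "\<dots> \<le> (\<Sum>l\<in>L ` Exc. card {w \<in> X. L w = l})"
      using finE by (intro card_UN_le) auto
    finally have "real (card Exc) \<le> (\<Sum>l\<in>L ` Exc. real (card {w \<in> X. L w = l}))"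
      by (rule nat_le_sum_imp_real_le)
    also have "\<dots> \<le> (\<Sum>l\<in>L ` Exc. t * real k)"
      by (rule sum_mono) (auto simp: Exc_def rare_def)
    also have "\<dots> = real (card (L ` Exc)) * (t * real k)" by simp
    also have "\<dots> \<le> real (4 ^ B * p) * (t * real k)"
      using cardL t by (intro mult_right_mono of_nat_mono) auto
    also have "\<dots> = (4 ^ B * real p * t) * real k" by simp
    also have "\<dots> \<le> \<epsilon> * real k" using t by (intro mult_right_mono) auto
    finally show "real (card {v \<in> rare L X (t * real k). \<not> (\<exists>D\<in>\<D>. v \<in> spot_verts D \<and>
                                 real (card (U \<inter> spot_verts D)) \<le> \<gamma>\<^sup>2 * real k)}) \<le> \<epsilon> * real k"
      by (simp add: Exc_def c_def)
  qed
qed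

lemma card_labels_of_common:
  assumes "finite X"
  shows "real (card (L ` (X - rare L X c))) * c \<le> real (card X)"
proof -
  let ?Y = "X - rare L X c"
  have "real (card (L ` ?Y)) * c = (\<Sum>l\<in>L ` ?Y. c)" by simp
  also have "\<dots> \<le> (\<Sum>l\<in>L ` ?Y. real (card {w \<in> X. L w = l}))"
    by (rule sum_mono) (auto simp: rare_def not_less)
  also have "\<dots> = real (\<Sum>l\<in>L ` ?Y. card {w \<in> X. L w = l})" by simp
  also have "(\<Sum>l\<in>L ` ?Y. card {w \<in> X. L w = l}) = card (\<Union>l\<in>L ` ?Y. {w \<in> X. L w = l})"
    using assms by (intro card_UN_disjoint[symmetric]) auto
  also have "\<dots> \<le> card X" using assms by (intro card_mono) auto
  finally show ?thesis by simp
qed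

section \<open>Clusters that respect a maximal packing\<close>

lemma edges_between_mono:
  "U' \<subseteq> U \<Longrightarrow> W' \<subseteq> W \<Longrightarrow> edges_between G U' W' \<subseteq> edges_between G U W"
  unfolding edges_between_def by blast

text \<open>Clusters that do not cross the classes of the spots. A pair of clusters joined by an edge of the
  packing then lies in the two classes of one spot, and between such clusters the edges of the
  packing are precisely those of \<open>G\<close>. Regularity for the relation of the packing and
  regularity in \<open>G\<close> therefore agree.\<close>

locale spot_clustering =
  fixes G :: "'a graph" and m \<gamma> \<epsilon> :: real and \<D> :: "'a spot set" and \<C> :: "'a set set"
  assumes simple: "simple_graph G"
    and \<gamma>: "\<gamma> > 0"
    and maximal: "maximal_spot_packing m \<gamma> G \<D>"
    and disjoint_clusters: "disjoint \<C>"
    and clusters_in: "\<Union>\<C> \<subseteq> verts G"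
    and homogeneous: "\<And>C U W F. C \<in> \<C> \<Longrightarrow> Spot (Upair U W) F \<in> \<D> \<Longrightarrow> C \<inter> U \<in> {{}, C}"
begin

definition spot_relation :: "('a \<times> 'a) set" where
  "spot_relation = {(x, y). {x, y} \<in> family_edges \<D>}"

definition regular_links :: "('a set \<times> 'a set) set" where
  "regular_links = {(C, C'). C \<in> \<C> \<and> C' \<in> \<C> \<and>
     (\<exists>U W F. Spot (Upair U W) F \<in> \<D> \<and> C \<subseteq> U \<and> C' \<subseteq> W) \<and>
     regular_pair \<epsilon> G C C' \<and> density G C C' \<ge> \<gamma>\<^sup>2}"

text \<open>The graph \<open>Greg\<close> of the decomposition. Its edges are taken from \<open>G\<close>, which makes the required
  equality of \<open>G[C,C']\<close> and \<open>Greg[C,C']\<close> immediate; that they avoid \<open>Gexp\<close> follows because the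
  packing covers them.\<close>

definition regular_graph :: "'a graph" where
  "regular_graph = \<lparr>verts = \<Union>\<C>, edges = (\<Union>(C, C')\<in>regular_links. edges_between G C C')\<rparr>"

lemma packing: "spot_packing m \<gamma> G \<D>"
  using maximal by (simp add: maximal_spot_packing_def)

lemma spot_props:
  assumes "Spot (Upair U W) F \<in> \<D>"
  shows "U \<inter> W = {}" "U \<subseteq> verts G" "W \<subseteq> verts G" "F \<subseteq> edges G"
    "\<And>e. e \<in> F \<Longrightarrow> \<exists>u\<in>U. \<exists>w\<in>W. e = {u, w}"
    "\<gamma> * (real (card U) * real (card W)) < real (card F)"
proof -
  have "dense_spot m \<gamma> G (Spot (Upair U W) F)" using packing assms by (simp add: spot_packing_def)
  note * = this[unfolded dense_spot_iff[OF simple]]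
  show "U \<inter> W = {}" "U \<subseteq> verts G" "W \<subseteq> verts G" "F \<subseteq> edges G"
    "\<And>e. e \<in> F \<Longrightarrow> \<exists>u\<in>U. \<exists>w\<in>W. e = {u, w}"
    "\<gamma> * (real (card U) * real (card W)) < real (card F)" using * by simp_all
qed

lemma edges_between_in_spot:
  assumes D: "Spot (Upair U W) F \<in> \<D>" and sub: "U' \<subseteq> U" "W' \<subseteq> W"
  shows "edges_between G U' W' = (\<lambda>(x, y). {x, y}) ` (spot_relation \<inter> U' \<times> W')"
    and "inj_on (\<lambda>(x, y). {x, y}) (spot_relation \<inter> U' \<times> W')"
proof -
  have "edges_between G U W \<subseteq> family_edges \<D>"
    by (rule maximal_spot_packing_covers[OF simple maximal D])
  then have "edges_between G U' W' \<subseteq> family_edges \<D>"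
    using edges_between_mono[OF sub] by blast
  moreover have "family_edges \<D> \<subseteq> edges G" by (rule spot_packing_edges[OF packing])
  ultimately show "edges_between G U' W' = (\<lambda>(x, y). {x, y}) ` (spot_relation \<inter> U' \<times> W')"
    by (auto simp: edges_between_def spot_relation_def image_iff)
  show "inj_on (\<lambda>(x, y). {x, y}) (spot_relation \<inter> U' \<times> W')"
  proof (rule inj_onI, clarify)
    fix x y x' y' assume "x \<in> U'" "y \<in> W'" "x' \<in> U'" "y' \<in> W'" "{x, y} = {x', y'}"
    moreover from this have "x \<noteq> y'" using spot_props(1)[OF D] sub by blast
    ultimately show "x = x' \<and> y = y'" by (auto simp: doubleton_eq_iff)
  qed
qed

lemma density_in_spot:
  assumes "Spot (Upair U W) F \<in> \<D>" "U' \<subseteq> U" "W' \<subseteq> W"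
  shows "density G U' W' = share spot_relation (U' \<times> W')"
  by (simp add: density_def share_def card_cartesian_product
      edges_between_in_spot(1)[OF assms] card_image[OF edges_between_in_spot(2)[OF assms]])

lemma regular_pair_in_spot:
  assumes D: "Spot (Upair U W) F \<in> \<D>" and sub: "C \<subseteq> U" "C' \<subseteq> W"
  shows "regular_pair \<epsilon> G C C' \<longleftrightarrow> uniform_pair \<epsilon> spot_relation C C'"
proof -
  have "density G U' W' = share spot_relation (U' \<times> W')" if "U' \<subseteq> C" "W' \<subseteq> C'" for U' W'
    using density_in_spot[OF D] sub that by blast
  moreover have "C \<inter> C' = {}" using spot_props(1)[OF D] sub by blast
  ultimately show ?thesis unfolding regular_pair_def uniform_pair_def by auto
qed

lemma cluster_eq: "C \<in> \<C> \<Longrightarrow> C' \<in> \<C> \<Longrightarrow> x \<in> C \<Longrightarrow> x \<in> C' \<Longrightarrow> C = C'"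
  using disjoint_clusters by (auto simp: disjoint_def)

lemma cluster_within_class:
  assumes "C \<in> \<C>" "Spot (Upair U W) F \<in> \<D>" "x \<in> C" "x \<in> U"
  shows "C \<subseteq> U"
  using homogeneous[OF assms(1,2)] assms(3,4) by auto

lemma regular_links_sym:
  assumes "(C, C') \<in> regular_links" shows "(C', C) \<in> regular_links"
proof -
  obtain U W F where D: "Spot (Upair U W) F \<in> \<D>" "C \<subseteq> U" "C' \<subseteq> W"
    using assms by (auto simp: regular_links_def)
  then have D': "Spot (Upair W U) F \<in> \<D>" by (metis Upair_inject)
  have sym: "edges_between G X Y = edges_between G Y X" for X Y
    by (auto simp: edges_between_def insert_commute)
  have dsym: "density G X Y = density G Y X" for X Y
    by (simp add: density_def sym[of X Y] mult.commute)
  have "regular_pair \<epsilon> G C' C"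
    using assms unfolding regular_links_def regular_pair_def
    by (auto simp: dsym[of C'] Int_commute) (metis dsym)
  then show ?thesis using assms D D' dsym unfolding regular_links_def by auto
qed

lemma regular_links_distinct:
  assumes "(C, C') \<in> regular_links" "x \<in> C" shows "C \<noteq> C'"
  using assms spot_props(1) by (fastforce simp: regular_links_def)

lemma regular_graph_edge:
  assumes "{x, y} \<in> edges regular_graph"
  shows "\<exists>C C'. (C, C') \<in> regular_links \<and> x \<in> C \<and> y \<in> C'"
proof -
  obtain C C' where CC: "(C, C') \<in> regular_links" "{x, y} \<in> edges_between G C C'"
    using assms by (auto simp: regular_graph_def)
  then have "x \<in> C \<and> y \<in> C' \<or> y \<in> C \<and> x \<in> C'"
    by (auto simp: edges_between_def doubleton_eq_iff)
  then show ?thesis using CC(1) regular_links_sym by blast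
qed

lemma edges_between_regular_graph:
  assumes "(C, C') \<in> regular_links"
  shows "edges_between G C C' = edges_between regular_graph C C'"
proof
  show "edges_between G C C' \<subseteq> edges_between regular_graph C C'"
    using assms by (auto simp: edges_between_def regular_graph_def)
  show "edges_between regular_graph C C' \<subseteq> edges_between G C C'"
    by (auto simp: edges_between_def regular_graph_def)
qed

lemma regular_graph_edges: "edges regular_graph \<subseteq> family_edges \<D>"
proof
  fix e assume "e \<in> edges regular_graph"
  then obtain C C' where "(C, C') \<in> regular_links" "e \<in> edges_between G C C'"
    by (auto simp: regular_graph_def)
  moreover then obtain U W F where "Spot (Upair U W) F \<in> \<D>" "C \<subseteq> U" "C' \<subseteq> W"
    by (auto simp: regular_links_def)
  ultimately have "Spot (Upair U W) F \<in> \<D>" "e \<in> edges_between G U W"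
    using edges_between_mono by blast+
  then show "e \<in> family_edges \<D>" using maximal_spot_packing_covers[OF simple maximal] by blast
qed

lemma regular_graph_subgraph:
  assumes "edges H \<inter> family_edges \<D> = {}"
  shows "subgraph regular_graph (delete_edges G H)"
proof -
  have "finite (verts G)" using simple by (simp add: simple_graph_def)
  then have "finite (\<Union>\<C>)" by (rule finite_subset[OF clusters_in])
  moreover have "card e = 2 \<and> e \<subseteq> \<Union>\<C>" if e: "e \<in> edges regular_graph" for e
  proof -
    obtain C C' where "(C, C') \<in> regular_links" "e \<in> edges_between G C C'"
      using e by (auto simp: regular_graph_def)
    then show ?thesis using simple
      by (auto simp: regular_links_def edges_between_def simple_graph_def)
  qed
  moreover have "edges regular_graph \<subseteq> edges G - edges H"
    using regular_graph_edges spot_packing_edges[OF packing] assms by blast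
  ultimately show ?thesis
    using clusters_in by (auto simp: subgraph_def delete_edges_def simple_graph_def regular_graph_def)
qed

lemma regular_graph_spot:
  assumes "C1 \<in> \<C>" "C2 \<in> \<C>" "edges_between regular_graph C1 C2 \<noteq> {}"
  shows "\<exists>U W F. Spot (Upair U W) F \<in> \<D> \<and> C1 \<subseteq> U \<and> C2 \<subseteq> W"
proof -
  obtain x y where xy: "x \<in> C1" "y \<in> C2" "{x, y} \<in> edges regular_graph"
    using assms(3) by (auto simp: edges_between_def)
  obtain C C' where "(C, C') \<in> regular_links" "x \<in> C" "y \<in> C'"
    using regular_graph_edge[OF xy(3)] by blast
  moreover from this have "C = C1" "C' = C2"
    using xy assms(1,2) cluster_eq by (auto simp: regular_links_def)
  ultimately show ?thesis by (auto simp: regular_links_def)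
qed

definition sparse_edges :: "'a spot \<Rightarrow> 'a set set" where
  "sparse_edges D = {e \<in> spot_edges D. \<exists>C\<in>\<C>. \<exists>C'\<in>\<C>. \<exists>x\<in>C. \<exists>y\<in>C'.
     e = {x, y} \<and> share spot_relation (C \<times> C') < \<gamma>\<^sup>2}"

lemma sym_spot_relation: "sym spot_relation"
  by (auto simp: sym_def spot_relation_def insert_commute)

text \<open>The cluster pairs of share below \<open>\<gamma>\<^sup>2\<close> inside the classes \<open>U\<close>, \<open>W\<close> of the spot are disjoint
  rectangles in \<open>U \<times> W\<close>, so they carry at most \<open>\<gamma>\<^sup>2|U||W|\<close> edges, and the spot itself has more than
  \<open>\<gamma>|U||W|\<close>.\<close>

lemma card_sparse_edges:
  assumes "D \<in> \<D>"
  shows "real (card (sparse_edges D)) \<le> \<gamma> * real (card (spot_edges D))"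
proof -
  obtain U W F where UWF: "D = Spot (Upair U W) F" by (rule spot_cases)
  with assms have D: "Spot (Upair U W) F \<in> \<D>" by simp
  note P = spot_props[OF D]
  have finV: "finite (verts G)" using simple by (simp add: simple_graph_def)
  have fin: "finite U" "finite W" using P(2,3) finV finite_subset by blast+
  have finC: "finite \<C>" using clusters_in finV by (metis finite_UnionD finite_subset)
  let ?E = spot_relation
  define Q where "Q = {(C, C'). C \<in> \<C> \<and> C' \<in> \<C> \<and> C \<subseteq> U \<and> C' \<subseteq> W \<and> share ?E (C \<times> C') < \<gamma>\<^sup>2}"
  have finQ: "finite Q" by (rule finite_subset[of _ "\<C> \<times> \<C>"]) (use finC in \<open>auto simp: Q_def\<close>)
  have finR: "finite (fst p \<times> snd p)" if "p \<in> Q" for p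
  proof -
    have "fst p \<subseteq> U" "snd p \<subseteq> W" using that by (auto simp: Q_def)
    then show ?thesis using fin finite_subset by blast
  qed
  have "sparse_edges D \<subseteq> (\<Union>p\<in>Q. (\<lambda>(x, y). {x, y}) ` (?E \<inter> fst p \<times> snd p))"
  proof
    fix e assume "e \<in> sparse_edges D"
    then obtain C C' x y where e: "e \<in> F" "C \<in> \<C>" "C' \<in> \<C>" "x \<in> C" "y \<in> C'" "e = {x, y}"
      "share ?E (C \<times> C') < \<gamma>\<^sup>2" by (auto simp: sparse_edges_def UWF)
    obtain u w where uw: "u \<in> U" "w \<in> W" "e = {u, w}" using P(5)[OF e(1)] by blast
    have "e \<in> family_edges \<D>" using D e(1) by (force simp: family_edges_def)
    then have uwE: "(u, w) \<in> ?E" by (simp add: spot_relation_def uw(3))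
    have D': "Spot (Upair W U) F \<in> \<D>" using D by (metis Upair_inject)
    consider "u = x" "w = y" | "u = y" "w = x" using e(6) uw(3) by (auto simp: doubleton_eq_iff)
    then have "\<exists>p\<in>Q. u \<in> fst p \<and> w \<in> snd p"
    proof cases
      case 1
      then have "(C, C') \<in> Q"
        using e uw cluster_within_class[OF e(2) D e(4)] cluster_within_class[OF e(3) D' e(5)]
        by (auto simp: Q_def)
      then show ?thesis using 1 e by force
    next
      case 2
      then have "(C', C) \<in> Q"
        using e uw cluster_within_class[OF e(2) D' e(4)] cluster_within_class[OF e(3) D e(5)]
          share_converse_sym[OF sym_spot_relation, of C C'] by (auto simp: Q_def)
      then show ?thesis using 2 e by force
    qed
    then show "e \<in> (\<Union>p\<in>Q. (\<lambda>(x, y). {x, y}) ` (?E \<inter> fst p \<times> snd p))"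
      using uwE uw(3) by fastforce
  qed
  then have "card (sparse_edges D) \<le> card (\<Union>p\<in>Q. (\<lambda>(x, y). {x, y}) ` (?E \<inter> fst p \<times> snd p))"
    by (rule card_mono[rotated]) (use finQ finR in blast)
  also have "\<dots> \<le> (\<Sum>p\<in>Q. card ((\<lambda>(x, y). {x, y}) ` (?E \<inter> fst p \<times> snd p)))"
    by (rule card_UN_le[OF finQ])
  also have "\<dots> \<le> (\<Sum>p\<in>Q. card (?E \<inter> fst p \<times> snd p))"
    using finR by (intro sum_mono card_image_le) blast
  finally have "real (card (sparse_edges D)) \<le> (\<Sum>p\<in>Q. real (card (?E \<inter> fst p \<times> snd p)))"
    by (rule nat_le_sum_imp_real_le)
  also have "\<dots> \<le> (\<Sum>p\<in>Q. \<gamma>\<^sup>2 * real (card (fst p \<times> snd p)))"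
  proof (rule sum_mono)
    fix p assume p: "p \<in> Q"
    have "real (card (?E \<inter> fst p \<times> snd p)) = real (card (fst p \<times> snd p)) * share ?E (fst p \<times> snd p)"
      using card_times_share[OF finR[OF p], of ?E] by simp
    also have "\<dots> \<le> real (card (fst p \<times> snd p)) * \<gamma>\<^sup>2"
      using p by (intro mult_left_mono) (auto simp: Q_def)
    finally show "real (card (?E \<inter> fst p \<times> snd p)) \<le> \<gamma>\<^sup>2 * real (card (fst p \<times> snd p))"
      by (simp add: mult.commute)
  qed
  also have "\<dots> = \<gamma>\<^sup>2 * real (\<Sum>p\<in>Q. card (fst p \<times> snd p))" by (simp add: sum_distrib_left)
  also have "(\<Sum>p\<in>Q. card (fst p \<times> snd p)) = card (\<Union>p\<in>Q. fst p \<times> snd p)"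
  proof (rule card_UN_disjoint[symmetric, OF finQ])
    have dis: "A \<inter> B = {}" if "A \<in> \<C>" "B \<in> \<C>" "A \<noteq> B" for A B
      using disjoint_clusters that by (simp add: disjoint_def)
    have in\<C>: "fst p \<in> \<C> \<and> snd p \<in> \<C>" if "p \<in> Q" for p using that by (auto simp: Q_def)
    show "\<forall>p\<in>Q. finite (fst p \<times> snd p)" using finR by blast
    show "\<forall>p\<in>Q. \<forall>q\<in>Q. p \<noteq> q \<longrightarrow> (fst p \<times> snd p) \<inter> (fst q \<times> snd q) = {}"
    proof (intro ballI impI)
      fix p q assume pq: "p \<in> Q" "q \<in> Q" "p \<noteq> q"
      then have "fst p \<noteq> fst q \<or> snd p \<noteq> snd q" by (simp add: prod_eq_iff)
      then have "fst p \<inter> fst q = {} \<or> snd p \<inter> snd q = {}"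
        using dis[of "fst p" "fst q"] dis[of "snd p" "snd q"] in\<C>[OF pq(1)] in\<C>[OF pq(2)] by blast
      then show "(fst p \<times> snd p) \<inter> (fst q \<times> snd q) = {}" by auto
    qed
  qed
  also have "\<gamma>\<^sup>2 * real (card (\<Union>p\<in>Q. fst p \<times> snd p)) \<le> \<gamma>\<^sup>2 * real (card (U \<times> W))"
    using fin by (intro mult_left_mono of_nat_mono card_mono) (auto simp: Q_def)
  also have "\<dots> = \<gamma> * (\<gamma> * (real (card U) * real (card W)))"
    by (simp add: card_cartesian_product power2_eq_square)
  also have "\<dots> \<le> \<gamma> * real (card F)" using P(6) \<gamma> by (intro mult_left_mono) auto
  finally show ?thesis by (simp add: UWF)
qed

text \<open>An edge of a spot has both ends in \<open>X\<close>. Unless one end is left over or lies in \<open>A\<close>, it joins two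
  clusters, which form a regular link, an irregular dense pair, or a sparse pair.\<close>

lemma card_lost_edges:
  assumes deg: "\<And>v. v \<in> verts G \<Longrightarrow> real (degree G v) \<le> \<Delta>"
    and X: "X = (\<Union>D\<in>\<D>. spot_verts D)"
  shows "real (card (family_edges \<D> - (edges regular_graph \<union> edges_between G A (A \<union> \<Union>\<C>))))
    \<le> real (card (X - A - \<Union>\<C>)) * \<Delta> + irregular_mass \<epsilon> (\<gamma>\<^sup>2) spot_relation \<C>
      + \<gamma> * real (card (edges G))"
proof -
  let ?E = spot_relation
  define Z where "Z = X - A - \<Union>\<C>"
  define S where "S = family_edges \<D> - (edges regular_graph \<union> edges_between G A (A \<union> \<Union>\<C>))"
  define S1 where "S1 = (\<Union>z\<in>Z. {e \<in> edges G. z \<in> e})"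
  define S2 where "S2 = (\<Union>p\<in>irregular_pairs \<epsilon> (\<gamma>\<^sup>2) ?E \<C>. (\<lambda>(x, y). {x, y}) ` (?E \<inter> fst p \<times> snd p))"
  define S3 where "S3 = (\<Union>D\<in>\<D>. sparse_edges D)"
  have finV: "finite (verts G)" using simple by (simp add: simple_graph_def)
  have finG: "finite (edges G)" by (rule finite_edges[OF simple])
  have FG: "family_edges \<D> \<subseteq> edges G" by (rule spot_packing_edges[OF packing])
  have finC: "finite \<C>" using clusters_in finV by (metis finite_UnionD finite_subset)
  have fin\<D>: "finite \<D>" by (rule finite_spot_packing[OF simple packing])
  have XV: "X \<subseteq> verts G"
  proof
    fix x assume "x \<in> X"
    then obtain D where D: "D \<in> \<D>" "x \<in> spot_verts D" by (auto simp: X)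
    obtain U W F where "D = Spot (Upair U W) F" by (rule spot_cases)
    then show "x \<in> verts G" using D spot_props(2,3)[of U W F] by (auto simp: spot_verts_def)
  qed
  have finZ: "finite Z" using XV finV by (auto simp: Z_def intro: finite_subset)
  have finI: "finite (irregular_pairs \<epsilon> (\<gamma>\<^sup>2) ?E \<C>)"
    by (rule finite_subset[of _ "\<C> \<times> \<C>"]) (use finC in \<open>auto simp: irregular_pairs_def\<close>)
  have finR: "finite (fst p \<times> snd p)" if "p \<in> irregular_pairs \<epsilon> (\<gamma>\<^sup>2) ?E \<C>" for p
  proof -
    have "fst p \<subseteq> verts G" "snd p \<subseteq> verts G" 
      using that clusters_in unfolding irregular_pairs_def by auto blast+
    then show ?thesis using finV finite_subset by blast
  qed
  have "S \<subseteq> S1 \<union> S2 \<union> S3"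
  proof
    fix e assume e: "e \<in> S"
    then obtain D where D: "D \<in> \<D>" "e \<in> spot_edges D" by (auto simp: S_def family_edges_def)
    obtain U W F where UWF: "D = Spot (Upair U W) F" by (rule spot_cases)
    then have Sp: "Spot (Upair U W) F \<in> \<D>" and eF: "e \<in> F" using D by auto
    then have Sp': "Spot (Upair W U) F \<in> \<D>" by (metis Upair_inject)
    obtain u w where uw: "u \<in> U" "w \<in> W" "e = {u, w}" using spot_props(5)[OF Sp eF] by blast
    have "spot_verts D = U \<union> W" by (simp add: UWF spot_verts_def)
    then have uwX: "u \<in> X" "w \<in> X" using uw(1,2) D(1) unfolding X by blast+
    have eG: "e \<in> edges G" and eF: "e \<in> family_edges \<D>" using e FG by (auto simp: S_def)
    have notG: "e \<notin> edges regular_graph" and notA: "e \<notin> edges_between G A (A \<union> \<Union>\<C>)"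
      using e by (auto simp: S_def)
    show "e \<in> S1 \<union> S2 \<union> S3"
    proof (cases "u \<in> Z \<or> w \<in> Z")
      case True
      then show ?thesis using eG uw by (auto simp: S1_def)
    next
      case False
      then have AC: "u \<in> A \<union> \<Union>\<C>" "w \<in> A \<union> \<Union>\<C>" using uwX by (auto simp: Z_def)
      have "u \<notin> A"
        using notA eG uw(3) AC(2) unfolding edges_between_def by blast
      moreover have "w \<notin> A"
        using notA eG uw(3) AC(1) insert_commute[of u w "{}"] unfolding edges_between_def by blast
      ultimately obtain C C' where C: "C \<in> \<C>" "u \<in> C" "C' \<in> \<C>" "w \<in> C'" using AC by blast
      have sub: "C \<subseteq> U" "C' \<subseteq> W"
        using cluster_within_class[OF C(1) Sp C(2) uw(1)] cluster_within_class[OF C(3) Sp' C(4) uw(2)] .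
      have dens: "density G C C' = share ?E (C \<times> C')" by (rule density_in_spot[OF Sp sub])
      have uwE: "(u, w) \<in> ?E" using eF by (simp add: spot_relation_def uw(3))
      show ?thesis
      proof (cases "share ?E (C \<times> C') < \<gamma>\<^sup>2")
        case True
        then have "e \<in> sparse_edges D" using D(2) C uw(3) by (auto simp: sparse_edges_def)
        then show ?thesis using D(1) by (auto simp: S3_def)
      next
        case False
        have "e \<in> edges_between G C C'" using eG uw(3) C by (auto simp: edges_between_def)
        then have "(C, C') \<notin> regular_links" using notG by (auto simp: regular_graph_def)
        moreover have spot: "\<exists>U W F. Spot (Upair U W) F \<in> \<D> \<and> C \<subseteq> U \<and> C' \<subseteq> W"
          using Sp sub by blast
        ultimately have "\<not> regular_pair \<epsilon> G C C'"
          using C(1,3) False dens unfolding regular_links_def mem_Collect_eq prod.case not_less by metis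
        then have "(C, C') \<in> irregular_pairs \<epsilon> (\<gamma>\<^sup>2) ?E \<C>"
          using C False regular_pair_in_spot[OF Sp sub] by (auto simp: irregular_pairs_def)
        then show ?thesis using uwE C uw(3) by (force simp: S2_def)
      qed
    qed
  qed
  moreover have "finite S1" "finite S2" "finite S3"
  proof -
    show "finite S1" using finG by (auto simp: S1_def intro: finite_subset)
    show "finite S2" using finI finR unfolding S2_def by blast
    have "S3 \<subseteq> edges G" using FG by (auto simp: S3_def sparse_edges_def family_edges_def)
    then show "finite S3" using finG finite_subset by blast
  qed
  ultimately have "card S \<le> card (S1 \<union> S2 \<union> S3)" by (intro card_mono) auto
  also have "\<dots> \<le> card S1 + card S2 + card S3"
    by (meson add_le_mono card_Un_le le_refl le_trans)
  finally have "real (card S) \<le> real (card S1) + real (card S2) + real (card S3)" by linarith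
  moreover have "real (card S1) \<le> real (card Z) * \<Delta>"
  proof -
    have "card S1 \<le> (\<Sum>z\<in>Z. card {e \<in> edges G. z \<in> e})" unfolding S1_def by (rule card_UN_le[OF finZ])
    then have "real (card S1) \<le> (\<Sum>z\<in>Z. real (card {e \<in> edges G. z \<in> e}))"
      by (rule nat_le_sum_imp_real_le)
    also have "\<dots> \<le> (\<Sum>z\<in>Z. \<Delta>)"
    proof (rule sum_mono)
      fix z assume "z \<in> Z"
      then have "z \<in> verts G" using XV by (auto simp: Z_def)
      then show "real (card {e \<in> edges G. z \<in> e}) \<le> \<Delta>"
        using deg card_edges_at[OF simple] by simp
    qed
    finally show ?thesis by simp
  qed
  moreover have "real (card S2) \<le> irregular_mass \<epsilon> (\<gamma>\<^sup>2) ?E \<C>"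
  proof -
    have "card S2 \<le> (\<Sum>p\<in>irregular_pairs \<epsilon> (\<gamma>\<^sup>2) ?E \<C>. card ((\<lambda>(x, y). {x, y}) ` (?E \<inter> fst p \<times> snd p)))"
      unfolding S2_def by (rule card_UN_le[OF finI])
    also have "\<dots> \<le> (\<Sum>p\<in>irregular_pairs \<epsilon> (\<gamma>\<^sup>2) ?E \<C>. card (?E \<inter> fst p \<times> snd p))"
      using finR by (intro sum_mono card_image_le) blast
    finally have "real (card S2) \<le> (\<Sum>p\<in>irregular_pairs \<epsilon> (\<gamma>\<^sup>2) ?E \<C>. real (card (?E \<inter> fst p \<times> snd p)))"
      by (rule nat_le_sum_imp_real_le)
    then show ?thesis by (simp add: irregular_mass_def case_prod_unfold)
  qed
  moreover have "real (card S3) \<le> \<gamma> * real (card (edges G))"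
  proof -
    have "card S3 \<le> (\<Sum>D\<in>\<D>. card (sparse_edges D))" unfolding S3_def by (rule card_UN_le[OF fin\<D>])
    then have "real (card S3) \<le> (\<Sum>D\<in>\<D>. real (card (sparse_edges D)))"
      by (rule nat_le_sum_imp_real_le)
    also have "\<dots> \<le> (\<Sum>D\<in>\<D>. \<gamma> * real (card (spot_edges D)))"
      by (rule sum_mono) (rule card_sparse_edges)
    also have "\<dots> = \<gamma> * real (\<Sum>D\<in>\<D>. card (spot_edges D))" by (simp add: sum_distrib_left)
    also have "(\<Sum>D\<in>\<D>. card (spot_edges D)) = card (family_edges \<D>)"
      unfolding family_edges_def
    proof (rule card_UN_disjoint[symmetric, OF fin\<D>])
      show "\<forall>D\<in>\<D>. finite (spot_edges D)"
        using FG finG by (auto simp: family_edges_def intro: finite_subset)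
    qed (use packing in \<open>auto simp: spot_packing_def disjoint_family_on_def\<close>)
    also have "\<gamma> * real (card (family_edges \<D>)) \<le> \<gamma> * real (card (edges G))"
      using \<gamma> FG finG by (intro mult_left_mono of_nat_mono card_mono) auto
    finally show ?thesis .
  qed
  ultimately show ?thesis by (simp add: S_def Z_def)
qed

end

section \<open>The decomposition\<close>

lemma bounded_spot_relation:
  assumes G: "simple_graph G" and \<D>: "spot_packing m \<gamma> G \<D>"
    and deg: "\<And>v. v \<in> verts G \<Longrightarrow> real (degree G v) \<le> \<Delta>" "\<Delta> \<ge> 0"
  shows "bounded_relation \<Delta> (verts G) {(x, y). {x, y} \<in> family_edges \<D>}"
proof -
  let ?E = "{(x, y). {x, y} \<in> family_edges \<D>}"
  have FG: "family_edges \<D> \<subseteq> edges G" by (rule spot_packing_edges[OF \<D>])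
  have finV: "finite (verts G)" using G by (simp add: simple_graph_def)
  have sub: "?E \<subseteq> verts G \<times> verts G" using edge_ends[OF G] FG by blast
  have "real (card (?E `` {x})) \<le> \<Delta>" for x
  proof (cases "x \<in> verts G")
    case True
    have "?E `` {x} \<subseteq> {u \<in> verts G. {x, u} \<in> edges G}" using sub FG by blast
    then have "card (?E `` {x}) \<le> degree G x"
      unfolding degree_def deg_in_def using finV by (intro card_mono) auto
    then show ?thesis using deg(1)[OF True] by linarith
  next
    case False
    then have "?E `` {x} = {}" using sub by blast
    then show ?thesis using deg(2) by (simp only: card.empty of_nat_0)
  qed
  then show ?thesis
    using finV sub by (auto simp: bounded_relation_def sym_def insert_commute)
qed

theorem lemma4p13:
  fixes \<Lambda> \<Omega> s :: nat and \<gamma> \<epsilon> \<rho> :: real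
  assumes "\<gamma> > 0" and "\<epsilon> > 0" and "\<rho> > 0"
  shows "\<exists>(k0 :: nat) (\<nu> :: real). \<nu> > 0 \<and>
    (\<forall>(k :: nat) (n :: nat) (G :: 'a graph) (\<V> :: 'a set set) (b :: real).
       k \<ge> k0 \<longrightarrow> simple_graph G \<longrightarrow> card (verts G) = n \<longrightarrow>
       card (edges G) \<le> k * n \<longrightarrow> max_degree G \<le> \<Omega> * k \<longrightarrow>
       partition_on (verts G) \<V> \<longrightarrow> card \<V> \<le> s \<longrightarrow>
       (\<exists>\<C> \<D> Greg Gexp A.
          bounded_decomposition k (real \<Lambda>) \<gamma> \<epsilon> \<nu> \<rho> G \<V> \<C> \<D> Greg Gexp A \<and>
          real (card (edges G - captured_edges G \<C> Greg Gexp A))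
            \<le> (4 * \<epsilon> / \<gamma> + \<epsilon> * real \<Omega> + \<gamma> + \<rho>) * real k * real n \<and>
          respects_threshold b G \<C> A \<and>
          real (card (family_edges \<D> - (edges Greg \<union> edges_between G A (A \<union> \<Union>\<C>))))
            \<le> (4 * \<epsilon> / \<gamma> + \<epsilon> * real \<Omega> + \<gamma>) * real k * real n))"
proof -
  define q where "q = real \<Omega> / \<gamma>"
  \<comment> \<open>\<open>q\<close> bounds the number of spots at a vertex, \<open>B\<close> the number of spots met in more than \<open>\<gamma>\<^sup>2k\<close>
      vertices by a set of size at most \<open>\<Lambda>k\<close>.\<close>
  define B where "B = nat \<lceil>q * real \<Lambda> / \<gamma>\<^sup>2\<rceil>"
  \<comment> \<open>The term 1 keeps the denominator positive when \<open>s = 0\<close>.\<close>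
  define t where "t = \<epsilon> / (4 ^ B * real (2 * s) + 1)"
  have t: "t > 0" using assms by (simp add: t_def add_pos_nonneg add_nonneg_pos)
  have t\<epsilon>: "4 ^ B * real (2 * s) * t \<le> \<epsilon>"
  proof -
    have "4 ^ B * real (2 * s) * t \<le> (4 ^ B * real (2 * s) + 1) * t" using t by simp
    also have "\<dots> = \<epsilon>"
      using add_nonneg_pos[of "4 ^ B * real (2 * s)" 1] by (simp add: t_def)
    finally show ?thesis .
  qed
  have B: "q * real \<Lambda> \<le> \<gamma>\<^sup>2 * real B"
  proof -
    have "q * real \<Lambda> / \<gamma>\<^sup>2 \<le> real B" unfolding B_def by linarith
    then show ?thesis using assms by (simp add: divide_le_eq mult.commute)
  qed
  have pos: "4 * \<epsilon> / \<gamma> > 0" "\<gamma>\<^sup>2 > 0" "t / 2 > 0" using assms t by auto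
  obtain \<nu> and k1 :: nat where \<nu>: "\<nu> > 0" and regularity:
    "\<forall>k\<ge>k1. \<forall>V E Y. \<forall>f :: 'a \<Rightarrow> ('a set set \<times> 'a set set \<times> bool) \<times> bool.
    bounded_relation (real \<Omega> * real k) V E \<longrightarrow> Y \<subseteq> V \<longrightarrow>
    real (card (f ` Y)) * (t / 2 * real k) \<le> real (card V) \<longrightarrow>
    (\<exists>\<C> m. equal_clusters Y f m \<C> \<and> \<nu> * real k \<le> real m \<and> real m \<le> \<epsilon> * real k \<and>
       real (card (Y - \<Union>\<C>)) \<le> \<epsilon> * real (card V) \<and>
       irregular_mass \<epsilon> (\<gamma>\<^sup>2) E \<C> \<le> 4 * \<epsilon> / \<gamma> * real k * real (card V))"
    using bounded_degree_regularity[OF assms(2) pos(1,2) assms(2) assms(2) pos(3),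
        where \<omega> = "real \<Omega>" and ?'a = 'a and ?'b = "('a set set \<times> 'a set set \<times> bool) \<times> bool"]
    by (elim exE conjE) (rule that)
  show ?thesis
  proof (rule exI[of _ "max k1 1"], rule exI[of _ \<nu>], intro conjI allI impI \<nu>)
    fix k n :: nat and G :: "'a graph" and \<V> :: "'a set set" and b :: real
    assume "max k1 1 \<le> k" and G: "simple_graph G" and n: "card (verts G) = n"
      and eG: "card (edges G) \<le> k * n" and max: "max_degree G \<le> \<Omega> * k"
      and \<V>: "partition_on (verts G) \<V>" and s: "card \<V> \<le> s"
    then have k: "k1 \<le> k" "k > 0" by auto
    have finV: "finite (verts G)" using G by (simp add: simple_graph_def)
    have deg: "real (degree G v) \<le> real \<Omega> * real k" if "v \<in> verts G" for v
    proof -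
      have "degree G v \<le> max_degree G"
        unfolding max_degree_def using finV that by (intro Max_ge) auto
      then have "degree G v \<le> \<Omega> * k" using max by linarith
      then show ?thesis by (metis of_nat_mono of_nat_mult)
    qed
    obtain \<D> where maximal: "maximal_spot_packing (\<gamma> * real k) \<gamma> G \<D>"
      using ex_maximal_spot_packing[OF G] by blast
    have packing: "spot_packing (\<gamma> * real k) \<gamma> G \<D>"
      using maximal by (simp add: maximal_spot_packing_def)
    have fin\<D>: "finite \<D>" by (rule finite_spot_packing[OF G packing])
    have FG: "family_edges \<D> \<subseteq> edges G" by (rule spot_packing_edges[OF packing])
    \<comment> \<open>The minimum degree of \<open>Gexp\<close> is enforced last: passing to a subgraph cannot create dense spots.\<close>
    define Grest where "Grest = \<lparr>verts = verts G, edges = edges G - family_edges \<D>\<rparr>"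
    have Grest: "simple_graph Grest" using G by (auto simp: Grest_def simple_graph_def)
    obtain Gexp where Gexp: "subgraph Gexp Grest" "min_degree Gexp > ereal (\<rho> * real k)"
      "real (card (edges Grest - edges Gexp)) \<le> \<rho> * real k * real (card (verts Grest))"
      using ex_large_min_degree_subgraph[OF Grest, of "\<rho> * real k"] assms(3) by auto
    have expG: "subgraph Gexp G" using Gexp(1) by (auto simp: subgraph_def Grest_def)
    have exp_disjoint: "edges Gexp \<inter> family_edges \<D> = {}"
      using Gexp(1) by (auto simp: subgraph_def Grest_def)
    have exp_sparse: "nowhere_dense_graph (\<gamma> * real k) \<gamma> Gexp"
      unfolding nowhere_dense_graph_def
    proof
      assume "\<exists>D. dense_spot (\<gamma> * real k) \<gamma> Gexp D"
      then obtain D where D: "dense_spot (\<gamma> * real k) \<gamma> Gexp D" by blast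
      then have "spot_edges D \<inter> family_edges \<D> \<noteq> {}"
        using maximal_spot_packing_no_more[OF G maximal] subgraph_dense_spot[OF _ expG] by blast
      then show False using dense_spot_edges[OF D] exp_disjoint by blast
    qed
    define X where "X = (\<Union>D\<in>\<D>. spot_verts D)"
    have spot_in: "spot_verts D \<subseteq> verts G" if "D \<in> \<D>" for D
      using packing that by (auto simp: spot_packing_def dense_spot_def subgraph_def spot_graph_def)
    then have XV: "X \<subseteq> verts G" unfolding X_def by blast
    have finX: "finite X" by (rule finite_subset[OF XV finV])
    define g where "g v = ({V \<in> \<V>. v \<in> V}, v \<in> verts Gexp)" for v
    define L where "L v = (spot_signature \<D> v, g v)" for v
    define A where "A = rare L X (t * real k)"
    have A: "A \<subseteq> X" by (auto simp: A_def rare_def)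
    have own: "{V' \<in> \<V>. v \<in> V'} = {V}" if "V \<in> \<V>" "v \<in> V" for V v
    proof -
      have "V' = V" if "V' \<in> \<V>" "v \<in> V'" for V'
        using \<V> that \<open>V \<in> \<V>\<close> \<open>v \<in> V\<close> by (auto simp: partition_on_def disjoint_def)
      then show ?thesis using that by blast
    qed
    have card_g: "card (g ` verts G) \<le> 2 * s"
    proof -
      have fin\<V>: "finite \<V>" by (rule finite_elements[OF finV \<V>])
      have "g ` verts G \<subseteq> (\<lambda>V. {V}) ` \<V> \<times> UNIV"
      proof
        fix y assume "y \<in> g ` verts G"
        then obtain v where v: "v \<in> verts G" "y = g v" by blast
        then obtain V where "V \<in> \<V>" "v \<in> V" using partition_onD1[OF \<V>] by blast
        then show "y \<in> (\<lambda>V. {V}) ` \<V> \<times> UNIV" using own[of V v] by (simp add: v(2) g_def)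
      qed
      then have "card (g ` verts G) \<le> card ((\<lambda>V. {V}) ` \<V> \<times> (UNIV :: bool set))"
        using fin\<V> by (intro card_mono) auto
      also have "\<dots> = card \<V> * 2" by (simp add: card_cartesian_product card_image)
      finally show ?thesis using s by simp
    qed
    have spots_at: "real (card {D \<in> \<D>. v \<in> spot_verts D}) \<le> q" if v: "v \<in> verts G" for v
    proof -
      have "real (card {D \<in> \<D>. v \<in> spot_verts D}) * (\<gamma> * real k) \<le> real \<Omega> * real k"
        using card_spots_at_vertex[OF G packing v] deg[OF v] by linarith
      then have "(real (card {D \<in> \<D>. v \<in> spot_verts D}) * \<gamma>) * real k \<le> real \<Omega> * real k" by simp
      then have "real (card {D \<in> \<D>. v \<in> spot_verts D}) * \<gamma> \<le> real \<Omega>"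
        using k(2) by (simp only: mult_le_cancel_right_pos of_nat_0_less_iff)
      then show ?thesis using assms(1) by (simp add: q_def le_divide_eq)
    qed
    have avoid: "avoiding (real \<Lambda>) \<epsilon> \<gamma> k G \<D> A"
      unfolding A_def L_def
    proof (rule avoiding_rare[OF G fin\<D> X_def XV k(2) assms(1) _ spots_at B card_g t t\<epsilon>])
      show "0 \<le> q" using assms(1) by (simp add: q_def)
    qed
    define Y where "Y = X - A"
    \<comment> \<open>The threshold enters only here, because it refers to \<open>A\<close>. The labels that refine \<open>L\<close> may be rare;
        only their number matters.\<close>
    define f where "f v = (L v, real (deg_in G v A) \<le> b)" for v
    have "real (card (f ` Y)) * (t / 2 * real k) \<le> real (card (verts G))"
    proof -
      have "f ` Y \<subseteq> L ` Y \<times> UNIV" by (auto simp: f_def)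
      then have "card (f ` Y) \<le> card (L ` Y \<times> (UNIV :: bool set))"
        using finX by (intro card_mono) (auto simp: Y_def)
      also have "\<dots> = card (L ` Y) * 2" by (simp add: card_cartesian_product)
      finally have "real (card (f ` Y)) \<le> real (card (L ` Y)) * 2" by linarith
      then have "real (card (f ` Y)) * (t / 2 * real k) \<le> real (card (L ` Y)) * 2 * (t / 2 * real k)"
        using t by (intro mult_right_mono) auto
      also have "\<dots> = real (card (L ` Y)) * (t * real k)" by simp
      also have "\<dots> \<le> real (card X)"
        unfolding Y_def A_def by (rule card_labels_of_common[OF finX])
      also have "\<dots> \<le> real (card (verts G))" using XV finV by (intro of_nat_mono card_mono)
      finally show ?thesis .
    qed
    moreover have "Y \<subseteq> verts G" using XV by (auto simp: Y_def)
    moreover have "bounded_relation (real \<Omega> * real k) (verts G) {(x, y). {x, y} \<in> family_edges \<D>}"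
      using deg by (intro bounded_spot_relation[OF G packing]) auto
    ultimately obtain \<C> m where \<C>: "equal_clusters Y f m \<C>" "\<nu> * real k \<le> real m" "real m \<le> \<epsilon> * real k"
      "real (card (Y - \<Union>\<C>)) \<le> \<epsilon> * real (card (verts G))"
      "irregular_mass \<epsilon> (\<gamma>\<^sup>2) {(x, y). {x, y} \<in> family_edges \<D>} \<C>
        \<le> 4 * \<epsilon> / \<gamma> * real k * real (card (verts G))"
      using regularity[rule_format, OF k(1)] by blast
    have cl: "disjoint \<C>" "\<Union>\<C> \<subseteq> Y" "\<And>C. C \<in> \<C> \<Longrightarrow> card C = m" "m > 0"
      "\<And>C x y. C \<in> \<C> \<Longrightarrow> x \<in> C \<Longrightarrow> y \<in> C \<Longrightarrow> f x = f y"
      using \<C>(1) unfolding equal_clusters_def by blast+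
    have ne: "\<exists>x. x \<in> C" if "C \<in> \<C>" for C
      using cl(3)[OF that] cl(4) by (metis card.empty ex_in_conv less_irrefl)
    \<comment> \<open>A class of a spot belongs to the signature of precisely its own vertices, and the signature is
        constant on a cluster.\<close>
    have homogeneous: "C \<inter> U \<in> {{}, C}" if "C \<in> \<C>" "Spot (Upair U W) F \<in> \<D>" for C U W F
    proof -
      have "y \<in> U" if "x \<in> C" "y \<in> C" "x \<in> U" for x y
      proof -
        have "spot_signature \<D> x = spot_signature \<D> y"
          using cl(5)[OF \<open>C \<in> \<C>\<close> that(1,2)] by (simp add: f_def L_def)
        moreover have "U \<in> spot_signature \<D> x"
          using that(3) \<open>Spot (Upair U W) F \<in> \<D>\<close> by (force simp: spot_signature_def)
        ultimately show ?thesis by (simp add: spot_signature_def)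
      qed
      then show ?thesis by blast
    qed
    interpret spot_clustering G "\<gamma> * real k" \<gamma> \<epsilon> \<D> \<C>
      using G assms(1) maximal cl(1,2) \<open>Y \<subseteq> verts G\<close> homogeneous by unfold_locales auto
    let ?Greg = regular_graph
    \<comment> \<open>The summands stand for leftover vertices, irregular dense pairs and sparse pairs.\<close>
    have lost: "real (card (family_edges \<D> - (edges ?Greg \<union> edges_between G A (A \<union> \<Union>\<C>))))
            \<le> (4 * \<epsilon> / \<gamma> + \<epsilon> * real \<Omega> + \<gamma>) * real k * real n"
    proof -
      have "real (card (family_edges \<D> - (edges ?Greg \<union> edges_between G A (A \<union> \<Union>\<C>))))
        \<le> real (card (X - A - \<Union>\<C>)) * (real \<Omega> * real k)
          + irregular_mass \<epsilon> (\<gamma>\<^sup>2) spot_relation \<C> + \<gamma> * real (card (edges G))"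
        by (rule card_lost_edges[OF deg X_def])
      also have "\<dots> \<le> \<epsilon> * real n * (real \<Omega> * real k) + 4 * \<epsilon> / \<gamma> * real k * real n + \<gamma> * (real k * real n)"
      proof (intro add_mono)
        show "real (card (X - A - \<Union>\<C>)) * (real \<Omega> * real k) \<le> \<epsilon> * real n * (real \<Omega> * real k)"
          using \<C>(4) n by (intro mult_right_mono) (auto simp: Y_def)
        show "irregular_mass \<epsilon> (\<gamma>\<^sup>2) spot_relation \<C> \<le> 4 * \<epsilon> / \<gamma> * real k * real n"
          using \<C>(5) n by (simp add: spot_relation_def)
        have "real (card (edges G)) \<le> real k * real n" using eG by (metis of_nat_mono of_nat_mult)
        then show "\<gamma> * real (card (edges G)) \<le> \<gamma> * (real k * real n)"
          using assms(1) by (intro mult_left_mono) auto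
      qed
      also have "\<dots> = (4 * \<epsilon> / \<gamma> + \<epsilon> * real \<Omega> + \<gamma>) * real k * real n"
        by (simp add: algebra_simps)
      finally show ?thesis .
    qed
    have uncaptured: "real (card (edges G - captured_edges G \<C> ?Greg Gexp A))
            \<le> (4 * \<epsilon> / \<gamma> + \<epsilon> * real \<Omega> + \<gamma> + \<rho>) * real k * real n"
    proof -
      let ?S = "family_edges \<D> - (edges ?Greg \<union> edges_between G A (A \<union> \<Union>\<C>))"
      have "edges G - captured_edges G \<C> ?Greg Gexp A \<subseteq> ?S \<union> (edges Grest - edges Gexp)"
        by (auto simp: captured_edges_def Grest_def)
      then have "card (edges G - captured_edges G \<C> ?Greg Gexp A) \<le> card (?S \<union> (edges Grest - edges Gexp))"
        using FG finite_edges[OF G] finite_edges[OF Grest]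
        by (intro card_mono) (auto intro: finite_subset)
      also have "\<dots> \<le> card ?S + card (edges Grest - edges Gexp)" by (rule card_Un_le)
      finally have "real (card (edges G - captured_edges G \<C> ?Greg Gexp A))
          \<le> real (card ?S) + real (card (edges Grest - edges Gexp))" by linarith
      also have "\<dots> \<le> (4 * \<epsilon> / \<gamma> + \<epsilon> * real \<Omega> + \<gamma>) * real k * real n + \<rho> * real k * real n"
        using lost Gexp(3) n by (intro add_mono) (auto simp: Grest_def)
      also have "\<dots> = (4 * \<epsilon> / \<gamma> + \<epsilon> * real \<Omega> + \<gamma> + \<rho>) * real k * real n"
        by (simp add: algebra_simps)
      finally show ?thesis .
    qed
    have threshold: "respects_threshold b G \<C> A"
      unfolding respects_threshold_def
    proof
      fix C assume C: "C \<in> \<C>"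
      have "(real (deg_in G x A) \<le> b) = (real (deg_in G y A) \<le> b)" if "x \<in> C" "y \<in> C" for x y
        using cl(5)[OF C that] by (simp add: f_def)
      then show "(\<forall>v\<in>C. real (deg_in G v A) \<le> b) \<or> (\<forall>v\<in>C. real (deg_in G v A) > b)"
        by (meson not_less)
    qed
    have "bounded_decomposition k (real \<Lambda>) \<gamma> \<epsilon> \<nu> \<rho> G \<V> \<C> \<D> ?Greg Gexp A"
      unfolding bounded_decomposition_def
    proof (intro conjI)
      show "disjoint \<C>" by (rule cl(1))
      show "\<forall>C\<in>\<C>. C \<subseteq> verts G" using clusters_in by blast
      show "subgraph ?Greg (delete_edges G Gexp)" by (rule regular_graph_subgraph[OF exp_disjoint])
      show "verts ?Greg = \<Union>\<C>" by (simp add: regular_graph_def)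
      show "\<forall>x y. {x, y} \<in> edges ?Greg \<longrightarrow>
         (\<exists>Cx\<in>\<C>. \<exists>Cy\<in>\<C>. Cx \<noteq> Cy \<and> x \<in> Cx \<and> y \<in> Cy \<and>
            edges_between G Cx Cy = edges_between ?Greg Cx Cy \<and>
            regular_pair \<epsilon> G Cx Cy \<and> density G Cx Cy \<ge> \<gamma>\<^sup>2)"
      proof (intro allI impI)
        fix x y assume "{x, y} \<in> edges ?Greg"
        then obtain C C' where C: "(C, C') \<in> regular_links" "x \<in> C" "y \<in> C'"
          using regular_graph_edge by blast
        then have "C \<in> \<C>" "C' \<in> \<C>" "regular_pair \<epsilon> G C C'" "density G C C' \<ge> \<gamma>\<^sup>2"
          by (auto simp: regular_links_def)
        then show "\<exists>Cx\<in>\<C>. \<exists>Cy\<in>\<C>. Cx \<noteq> Cy \<and> x \<in> Cx \<and> y \<in> Cy \<and>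
            edges_between G Cx Cy = edges_between ?Greg Cx Cy \<and>
            regular_pair \<epsilon> G Cx Cy \<and> density G Cx Cy \<ge> \<gamma>\<^sup>2"
          using C regular_links_distinct[OF C(1,2)] edges_between_regular_graph[OF C(1)] by blast
      qed
      show "\<forall>C\<in>\<C>. \<forall>C'\<in>\<C>. \<nu> * real k \<le> real (card C) \<and> card C = card C' \<and>
         real (card C') \<le> \<epsilon> * real k"
        using cl(3) \<C>(2,3) by simp
      show "\<forall>D\<in>\<D>. dense_spot (\<gamma> * real k) \<gamma> (delete_edges G Gexp) D"
      proof
        fix D assume D: "D \<in> \<D>"
        then have "spot_edges D \<inter> edges Gexp = {}" using exp_disjoint by (auto simp: family_edges_def)
        moreover have "dense_spot (\<gamma> * real k) \<gamma> G D" using D packing by (simp add: spot_packing_def)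
        moreover have "subgraph (spot_graph D) (delete_edges G Gexp)"
          if "subgraph (spot_graph D) G" "spot_edges D \<inter> edges Gexp = {}"
          using that by (auto simp: subgraph_def delete_edges_def spot_graph_def)
        ultimately show "dense_spot (\<gamma> * real k) \<gamma> (delete_edges G Gexp) D"
          unfolding dense_spot_def by blast
      qed
      show "disjoint_family_on spot_edges \<D>" using packing by (simp add: spot_packing_def)
      show "\<forall>U W F. Spot (Upair U W) F \<in> \<D> \<longrightarrow> edges_between G U W \<subseteq> family_edges \<D>"
        using maximal_spot_packing_covers[OF G maximal] by blast
      show "\<forall>C1\<in>\<C>. \<forall>C2\<in>\<C>. edges_between ?Greg C1 C2 \<noteq> {} \<longrightarrow>
        (\<exists>U W F. Spot (Upair U W) F \<in> \<D> \<and> C1 \<subseteq> U \<and> C2 \<subseteq> W)"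
        using regular_graph_spot by blast
      show "\<forall>C\<in>\<C>. \<exists>V\<in>\<V>. C \<subseteq> V \<inter> verts Gexp \<or> C \<subseteq> V - verts Gexp"
      proof
        fix C assume C: "C \<in> \<C>"
        then obtain x where x: "x \<in> C" using ne by blast
        then have "x \<in> verts G" using C clusters_in by blast
        then obtain V where V: "V \<in> \<V>" "x \<in> V" using partition_onD1[OF \<V>] by blast
        have "y \<in> V \<and> (y \<in> verts Gexp \<longleftrightarrow> x \<in> verts Gexp)" if "y \<in> C" for y
        proof -
          have "g y = g x" using cl(5)[OF C that x] by (simp add: f_def L_def)
          then have "{V \<in> \<V>. y \<in> V} = {V}" "y \<in> verts Gexp \<longleftrightarrow> x \<in> verts Gexp"
            using own[OF V] by (auto simp: g_def)
          then show ?thesis by blast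
        qed
        then show "\<exists>V\<in>\<V>. C \<subseteq> V \<inter> verts Gexp \<or> C \<subseteq> V - verts Gexp" using V(1) by blast
      qed
      show "\<forall>C\<in>\<C>. \<forall>U W F. Spot (Upair U W) F \<in> \<D> \<longrightarrow> C \<inter> U \<in> {{}, C}"
        using homogeneous by blast
      show "subgraph Gexp G" by (rule expG)
      show "nowhere_dense_graph (\<gamma> * real k) \<gamma> Gexp" by (rule exp_sparse)
      show "min_degree Gexp > ereal (\<rho> * real k)" by (rule Gexp(2))
      show "A \<subseteq> verts G - \<Union>\<C>" using A XV cl(2) by (auto simp: Y_def)
      show "avoiding (real \<Lambda>) \<epsilon> \<gamma> k G \<D> A" by (rule avoid)
    qed
    then show "\<exists>\<C> \<D> Greg Gexp A.
          bounded_decomposition k (real \<Lambda>) \<gamma> \<epsilon> \<nu> \<rho> G \<V> \<C> \<D> Greg Gexp A \<and>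
          real (card (edges G - captured_edges G \<C> Greg Gexp A))
            \<le> (4 * \<epsilon> / \<gamma> + \<epsilon> * real \<Omega> + \<gamma> + \<rho>) * real k * real n \<and>
          respects_threshold b G \<C> A \<and>
          real (card (family_edges \<D> - (edges Greg \<union> edges_between G A (A \<union> \<Union>\<C>))))
            \<le> (4 * \<epsilon> / \<gamma> + \<epsilon> * real \<Omega> + \<gamma>) * real k * real n"
      using uncaptured threshold lost by blast
  qed
qed

end
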